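(* Let $p\ge3$ be an integer. The growth function $S(x)=\sum_{n=0}^\infty s_nx^n$ of positive elements in $F(p)$ is irrational, i.e. the power series $S(x)$ is not the power series expansion of a rational function of $x$.
   Context: For an integer $p\ge2$, the generalized Thompson group $F(p)$ is the group given by the presentation $\langle x_i\ (i\ge0)\mid x_jx_i=x_ix_{j+p-1}\ (0\le i<j)\rangle$. It is generated by $x_0,x_1,\dots,x_{p-1}$. The submonoid $F_+(p)\subset F(p)$ is the set of all elements that can be expressed as products of the generators $x_i$ ($i\ge0$) with no inverses (it includes the identity); its elements are called positive. Here $s_n$ is the number of elements of $F_+(p)$ whose word length in $F(p)$ with respect to the generating set $\{x_0,\dots,x_{p-1}\}$ (inverses allowed) is exactly $n$. *)

theory Defs
  imports "HOL-Algebra.Group" "HOL-Computational_Algebra.Polynomial_FPS"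
begin

section \<open>Groups given by generators and relations\<close>

text \<open>A letter \<open>(a, True)\<close> stands for the generator \<open>a\<close> and \<open>(a, False)\<close> for its formal
  inverse. Every element of the type \<open>'a\<close> is a generator; a relation \<open>u = v\<close> is given as the
  pair \<open>(u, v)\<close>.\<close>

type_synonym 'a word = "('a \<times> bool) list"

inductive pres_eq :: "('a word \<times> 'a word) set \<Rightarrow> 'a word \<Rightarrow> 'a word \<Rightarrow> bool"
  for R :: "('a word \<times> 'a word) set" where
  refl: "pres_eq R u u"
| sym: "pres_eq R u v \<Longrightarrow> pres_eq R v u"
| trans: "pres_eq R u v \<Longrightarrow> pres_eq R v w \<Longrightarrow> pres_eq R u w"
| cong: "pres_eq R u u' \<Longrightarrow> pres_eq R v v' \<Longrightarrow> pres_eq R (u @ v) (u' @ v')"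
| cancel: "pres_eq R [(a, b), (a, \<not> b)] []"
| rel: "(u, v) \<in> R \<Longrightarrow> pres_eq R u v"

definition pres_rel :: "('a word \<times> 'a word) set \<Rightarrow> ('a word \<times> 'a word) set" where
  "pres_rel R = {(u, v). pres_eq R u v}"

definition presented_group :: "('a word \<times> 'a word) set \<Rightarrow> 'a word set monoid" where
  "presented_group R =
     \<lparr>carrier = UNIV // pres_rel R,
      monoid.mult = (\<lambda>A B. \<Union>u\<in>A. \<Union>v\<in>B. pres_rel R `` {u @ v}),
      monoid.one = pres_rel R `` {[]}\<rparr>"

definition pres_gen :: "('a word \<times> 'a word) set \<Rightarrow> 'a \<Rightarrow> 'a word set" where
  "pres_gen R a = pres_rel R `` {[(a, True)]}"

lemma equiv_pres_rel: "equiv UNIV (pres_rel R)"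
  by (auto simp: equiv_def refl_on_def sym_def trans_def pres_rel_def
      intro: pres_eq.refl pres_eq.sym pres_eq.trans)

lemma pres_class_eq_iff: "pres_rel R `` {u} = pres_rel R `` {v} \<longleftrightarrow> pres_eq R u v"
  using eq_equiv_class_iff[OF equiv_pres_rel, of u v R] by (simp add: pres_rel_def)

lemma presented_group_mult:
  "pres_rel R `` {u} \<otimes>\<^bsub>presented_group R\<^esub> pres_rel R `` {v} = pres_rel R `` {u @ v}"
proof -
  have c: "congruent2 (pres_rel R) (pres_rel R) (\<lambda>u v. pres_rel R `` {u @ v})"
    unfolding congruent2_def pres_class_eq_iff by (auto simp: pres_rel_def intro: pres_eq.cong)
  show ?thesis
    using UN_equiv_class2[OF equiv_pres_rel equiv_pres_rel c, of u v]
    by (simp add: presented_group_def)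
qed

lemma presented_group_carrierE:
  assumes "x \<in> carrier (presented_group R)"
  obtains u where "x = pres_rel R `` {u}"
  using assms by (auto simp: presented_group_def elim: quotientE)

lemma pres_class_in_carrier: "pres_rel R `` {u} \<in> carrier (presented_group R)"
  by (simp add: presented_group_def quotientI)

lemma pres_eq_left_inverse: "\<exists>v. pres_eq R (v @ u) []"
proof (induction u)
  case Nil
  show ?case by (intro exI[of _ "[]"]) (simp add: pres_eq.refl)
next
  case (Cons c u)
  then obtain v where v: "pres_eq R (v @ u) []" by blast
  obtain a b where c: "c = (a, b)" by fastforce
  have "pres_eq R ([(a, \<not> b), (a, b)] @ u) ([] @ u)"
    using pres_eq.cong[OF pres_eq.cancel[of R a "\<not> b"] pres_eq.refl[of R u]] by simp
  then have "pres_eq R (v @ ([(a, \<not> b), (a, b)] @ u)) (v @ ([] @ u))"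
    by (rule pres_eq.cong[OF pres_eq.refl])
  then have "pres_eq R ((v @ [(a, \<not> b)]) @ c # u) []"
    using v by (auto simp: c intro: pres_eq.trans)
  then show ?case by blast
qed

lemma group_presented_group: "group (presented_group R)"
proof (rule groupI)
  show one: "\<one>\<^bsub>presented_group R\<^esub> \<in> carrier (presented_group R)"
    by (simp add: presented_group_def quotientI)
  have one_eq: "\<one>\<^bsub>presented_group R\<^esub> = pres_rel R `` {[]}"
    by (simp add: presented_group_def)
  fix x assume x: "x \<in> carrier (presented_group R)"
  then obtain u where u: "x = pres_rel R `` {u}" by (rule presented_group_carrierE)
  show "\<one>\<^bsub>presented_group R\<^esub> \<otimes>\<^bsub>presented_group R\<^esub> x = x"
    by (simp add: u one_eq presented_group_mult)
  obtain v where "pres_eq R (v @ u) []" using pres_eq_left_inverse by blast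
  then have "pres_rel R `` {v} \<otimes>\<^bsub>presented_group R\<^esub> x = \<one>\<^bsub>presented_group R\<^esub>"
    by (simp add: u one_eq presented_group_mult pres_class_eq_iff)
  then show "\<exists>y\<in>carrier (presented_group R). y \<otimes>\<^bsub>presented_group R\<^esub> x = \<one>\<^bsub>presented_group R\<^esub>"
    using pres_class_in_carrier by blast
  fix y assume y: "y \<in> carrier (presented_group R)"
  then obtain v where v: "y = pres_rel R `` {v}" by (rule presented_group_carrierE)
  show "x \<otimes>\<^bsub>presented_group R\<^esub> y \<in> carrier (presented_group R)"
    by (simp add: u v presented_group_mult pres_class_in_carrier)
  fix z assume z: "z \<in> carrier (presented_group R)"
  then obtain w where w: "z = pres_rel R `` {w}" by (rule presented_group_carrierE)
  show "x \<otimes>\<^bsub>presented_group R\<^esub> y \<otimes>\<^bsub>presented_group R\<^esub> z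
      = x \<otimes>\<^bsub>presented_group R\<^esub> (y \<otimes>\<^bsub>presented_group R\<^esub> z)"
    by (simp add: u v w presented_group_mult)
qed

section \<open>Word length\<close>

definition list_mult :: "('a, 'b) monoid_scheme \<Rightarrow> 'a list \<Rightarrow> 'a" where
  "list_mult G gs = foldr (\<otimes>\<^bsub>G\<^esub>) gs \<one>\<^bsub>G\<^esub>"

text \<open>The \<open>LEAST\<close> is meaningful only for \<open>g\<close> in the subgroup generated by \<open>X\<close>; for the use below
  see \<open>thompson_finitely_generated\<close>.\<close>

definition word_length :: "('a, 'b) monoid_scheme \<Rightarrow> 'a set \<Rightarrow> 'a \<Rightarrow> nat" where
  "word_length G X g =
     (LEAST n. \<exists>gs. set gs \<subseteq> X \<union> m_inv G ` X \<and> length gs = n \<and> list_mult G gs = g)"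

section \<open>The generalized Thompson group \<open>F(p)\<close>\<close>

definition thompson_relations :: "nat \<Rightarrow> (nat word \<times> nat word) set" where
  "thompson_relations p =
     {([(j, True), (i, True)], [(i, True), (j + p - 1, True)]) | i j. i < j}"

definition thompson :: "nat \<Rightarrow> nat word set monoid" where
  "thompson p = presented_group (thompson_relations p)"

definition thompson_gen :: "nat \<Rightarrow> nat \<Rightarrow> nat word set" where
  "thompson_gen p i = pres_gen (thompson_relations p) i"

definition thompson_pos :: "nat \<Rightarrow> nat word set set" where
  "thompson_pos p = {list_mult (thompson p) gs | gs. set gs \<subseteq> range (thompson_gen p)}"

lemma group_thompson: "group (thompson p)"
  unfolding thompson_def by (rule group_presented_group)

lemma thompson_gen_closed: "thompson_gen p i \<in> carrier (thompson p)"
  by (simp add: thompson_def thompson_gen_def pres_gen_def pres_class_in_carrier)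

lemma thompson_gen_rel:
  assumes "i < j"
  shows "thompson_gen p j \<otimes>\<^bsub>thompson p\<^esub> thompson_gen p i
      = thompson_gen p i \<otimes>\<^bsub>thompson p\<^esub> thompson_gen p (j + p - 1)"
  using assms unfolding thompson_def thompson_gen_def pres_gen_def
  by (auto simp: presented_group_mult pres_class_eq_iff thompson_relations_def intro!: pres_eq.rel)

lemma list_mult_closed:
  assumes "group G" "set gs \<subseteq> carrier G"
  shows "list_mult G gs \<in> carrier G"
proof -
  interpret group G by fact
  show ?thesis using assms(2) by (induction gs) (auto simp: list_mult_def)
qed

lemma list_mult_append:
  assumes "group G" "set gs \<subseteq> carrier G" "set hs \<subseteq> carrier G"
  shows "list_mult G (gs @ hs) = list_mult G gs \<otimes>\<^bsub>G\<^esub> list_mult G hs"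
proof -
  interpret group G by fact
  show ?thesis using assms(2,3)
  proof (induction gs)
    case Nil
    then show ?case
      using list_mult_closed[OF assms(1), of hs] by (simp add: list_mult_def)
  next
    case (Cons a gs)
    then have "list_mult G gs \<in> carrier G" "list_mult G hs \<in> carrier G"
      using list_mult_closed[OF assms(1)] by auto
    with Cons show ?case by (simp add: list_mult_def m_assoc)
  qed
qed

lemma thompson_finitely_generated:
  assumes p: "p \<ge> 2" and g: "g \<in> carrier (thompson p)"
  shows "\<exists>gs. set gs \<subseteq> thompson_gen p ` {0..<p} \<union> m_inv (thompson p) ` thompson_gen p ` {0..<p}
    \<and> list_mult (thompson p) gs = g"
proof -
  interpret group "thompson p" by (rule group_thompson)
  define X where "X = thompson_gen p ` {0..<p} \<union> m_inv (thompson p) ` thompson_gen p ` {0..<p}"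
  define W where "W = {list_mult (thompson p) gs | gs. set gs \<subseteq> X}"
  have Xc: "X \<subseteq> carrier (thompson p)" by (auto simp: X_def thompson_gen_closed)
  have mW: "a \<otimes>\<^bsub>thompson p\<^esub> b \<in> W" if ab: "a \<in> W" "b \<in> W" for a b
  proof -
    obtain gs hs where gs: "set gs \<subseteq> X" "a = list_mult (thompson p) gs"
      and hs: "set hs \<subseteq> X" "b = list_mult (thompson p) hs"
      using ab unfolding W_def by blast
    have "a \<otimes>\<^bsub>thompson p\<^esub> b = list_mult (thompson p) (gs @ hs)"
      using list_mult_append[OF group_thompson, of gs p hs] gs hs Xc by auto
    then show ?thesis unfolding W_def using gs(1) hs(1) by (intro CollectI exI[of _ "gs @ hs"]) auto
  qed
  have XW: "a \<in> W" if "a \<in> X" for a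
    unfolding W_def using that Xc by (intro CollectI exI[of _ "[a]"]) (auto simp: list_mult_def)
  have gW: "thompson_gen p i \<in> W \<and> inv\<^bsub>thompson p\<^esub> (thompson_gen p i) \<in> W" for i
  proof (induction i rule: less_induct)
    case (less i)
    show ?case
    proof (cases "i < p")
      case True
      then show ?thesis by (auto intro!: XW simp: X_def)
    next
      case False
      define k where "k = i - (p - 1)"
      have k: "k + p - 1 = i" "0 < k" "k < i" using False p by (auto simp: k_def)
      let ?x = "thompson_gen p"
      have c: "?x n \<in> carrier (thompson p)" for n by (rule thompson_gen_closed)
      have r: "?x k \<otimes>\<^bsub>thompson p\<^esub> ?x 0 = ?x 0 \<otimes>\<^bsub>thompson p\<^esub> ?x i"
        using thompson_gen_rel[of 0 k p] k by simp
      have e: "?x i = inv\<^bsub>thompson p\<^esub> (?x 0) \<otimes>\<^bsub>thompson p\<^esub> (?x k \<otimes>\<^bsub>thompson p\<^esub> ?x 0)"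
        unfolding r by (simp add: c m_assoc[symmetric])
      have e': "inv\<^bsub>thompson p\<^esub> (?x i)
          = inv\<^bsub>thompson p\<^esub> (?x 0) \<otimes>\<^bsub>thompson p\<^esub> (inv\<^bsub>thompson p\<^esub> (?x k) \<otimes>\<^bsub>thompson p\<^esub> ?x 0)"
        unfolding e by (simp add: c inv_mult_group m_assoc)
      have 0: "?x 0 \<in> W" "inv\<^bsub>thompson p\<^esub> (?x 0) \<in> W" using p by (auto intro!: XW simp: X_def)
      show ?thesis unfolding e' unfolding e using 0 less.IH[OF k(3)] by (intro conjI mW) auto
    qed
  qed
  have lW: "pres_rel (thompson_relations p) `` {[c]} \<in> W" for c
  proof -
    obtain a b where c: "c = (a, b)" by fastforce
    let ?y = "pres_rel (thompson_relations p) `` {[(a, False)]}"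
    have "?y \<otimes>\<^bsub>thompson p\<^esub> thompson_gen p a = \<one>\<^bsub>thompson p\<^esub>"
      using pres_eq.cancel[of "thompson_relations p" a False]
      by (simp add: thompson_def thompson_gen_def pres_gen_def presented_group_mult)
        (simp add: presented_group_def pres_class_eq_iff)
    moreover have "?y \<in> carrier (thompson p)"
      by (simp add: thompson_def pres_class_in_carrier)
    ultimately have "inv\<^bsub>thompson p\<^esub> (thompson_gen p a) = ?y"
      by (intro inv_equality thompson_gen_closed)
    then show ?thesis using gW[of a] by (cases b) (auto simp: c thompson_gen_def pres_gen_def)
  qed
  have "pres_rel (thompson_relations p) `` {u} \<in> W" for u
  proof (induction u)
    case Nil
    show ?case unfolding W_def
      by (intro CollectI exI[of _ "[]"])
        (simp add: list_mult_def thompson_def presented_group_def)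
  next
    case (Cons c u)
    show ?case
      using mW[OF lW[of c] Cons.IH] by (simp add: thompson_def presented_group_mult)
  qed
  then have "g \<in> W" using g by (auto simp: thompson_def elim: presented_group_carrierE)
  then show ?thesis unfolding W_def X_def by blast
qed

definition pos_count :: "nat \<Rightarrow> nat \<Rightarrow> nat" where
  "pos_count p n = card {g \<in> thompson_pos p. word_length (thompson p) (thompson_gen p ` {0..<p}) g = n}"

definition pos_growth :: "nat \<Rightarrow> complex fps" where
  "pos_growth p = Abs_fps (\<lambda>n. of_nat (pos_count p n))"

section \<open>Rational power series\<close>

text \<open>\<open>f = P / Q\<close> for some rational function \<open>P / Q\<close>. Denominators vanishing at \<open>0\<close> are admitted,
  which makes no difference, since a common power of the variable can be cancelled.\<close>

definition rational_fps :: "'a::field fps \<Rightarrow> bool" where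
  "rational_fps f \<longleftrightarrow> (\<exists>P Q. Q \<noteq> 0 \<and> f * fps_of_poly Q = fps_of_poly P)"

end

theory Submission
  imports Defs "HOL-Computational_Algebra.Polynomial_Factorial" "HOL-Computational_Algebra.Field_as_Ring"
begin

text \<open>Write \<open>n = p - 1\<close>. An element of \<open>F\<^sub>+(p)\<close> is \<open>x\<^sub>0\<^sup>a\<close> times a forest of \<open>p\<close>-ary trees, where \<open>x\<^sub>j\<^sub>+\<^sub>1\<close> splits
  the \<open>j\<close>-th leaf. In the finite generating set, \<open>x\<^sub>1, \<dots>, x\<^sub>n\<close> split a leaf of the window of \<open>n\<close> leaves at a
  pointer, and \<open>x\<^sub>0\<close> moves the pointer by one window. The group acts on the boundaries between windows, those
  that arise inside future carets included, and every letter changes the position relative to the pointer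
  (left, right, or swallowed by a caret) of exactly one boundary. Counting these changes boundary by boundary
  gives the exact length of a positive element: a caret costs 1, and 2 more if one of its children
  beyond the new boundary is not a leaf.

  The generating functions of trees at the different positions in a window then satisfy a recursion of
  linear fractional type, whose solution is that \<open>q = 1 - X\<^sup>3 P\<close>, for the series \<open>P\<close> of one window,
  is a root of \<open>y\<^sup>p - (1 + X - X\<^sup>3) y\<^sup>p\<^sup>-\<^sup>1 + X\<close>. This trinomial is irreducible. Since \<open>S\<close> is a rational function of
  degree 2 in \<open>q\<close>, rationality of \<open>S\<close> would give \<open>q\<close> degree at most 2, contradicting \<open>p \<ge> 3\<close>.\<close>

section \<open>The action on boundaries\<close>

text \<open>\<open>Gap m\<close> is the boundary to the left of leaf \<open>m * n\<close>, the window at the pointer being \<open>{0..<n}\<close>.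
  \<open>Mid k ds\<close> is the boundary that arises when the descendant of leaf \<open>k\<close> with address \<open>ds\<close> is split.\<close>

datatype boundary = Gap int | Mid int "nat list"

text \<open>Positions are relative to the pointer, so \<open>x_0\<close> adds \<open>n\<close> to
  each. Splitting leaf \<open>j\<close> makes leaves \<open>j\<close> to \<open>j + n\<close>. The
  only multiple of \<open>n\<close> from \<open>j + 1\<close> to \<open>j + n\<close>, namely
  \<open>(j div n + 1) * n\<close>, is the boundary that emerges from
  \<open>Mid j []\<close>.\<close>

fun act_letter :: "nat \<Rightarrow> nat \<times> bool \<Rightarrow> boundary \<Rightarrow> boundary" where
  "act_letter n (0, b) (Gap m) = Gap (if b then m + 1 else m - 1)"
| "act_letter n (0, b) (Mid k ds) = Mid (if b then k + int n else k - int n) ds"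
| "act_letter n (Suc j, True) (Gap m) = Gap (if m * int n \<le> int j then m else m + 1)"
| "act_letter n (Suc j, True) (Mid k ds) =
     (if k < int j then Mid k ds else if k > int j then Mid (k + int n) ds
      else case ds of [] \<Rightarrow> Gap (int (j div n) + 1) | d # ds' \<Rightarrow> Mid (k + int d) ds')"
| "act_letter n (Suc j, False) (Gap m) =
     (if m * int n \<le> int j then Gap m else if m = int (j div n) + 1 then Mid (int j) []
      else Gap (m - 1))"
| "act_letter n (Suc j, False) (Mid k ds) =
     (if k < int j then Mid k ds else if k > int (j + n) then Mid (k - int n) ds
      else Mid (int j) (nat (k - int j) # ds))"

abbreviation act :: "nat \<Rightarrow> nat word \<Rightarrow> boundary \<Rightarrow> boundary" where
  "act n \<equiv> fold (act_letter n)"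

fun digits :: "boundary \<Rightarrow> nat list" where
  "digits (Gap m) = []"
| "digits (Mid k ds) = ds"

text \<open>With digits above \<open>n\<close> the letters would not act injectively.\<close>

definition boundaries :: "nat \<Rightarrow> boundary set" where
  "boundaries n = {b. set (digits b) \<subseteq> {..n}}"

lemma boundaries_simps [simp]:
  "Gap m \<in> boundaries n" "Mid k ds \<in> boundaries n \<longleftrightarrow> set ds \<subseteq> {..n}"
  by (auto simp: boundaries_def)

lemma act_letter_closed:
  assumes "b \<in> boundaries n"
  shows "act_letter n s b \<in> boundaries n"
  using assms by (cases "(n, s, b)" rule: act_letter.cases) (auto split: list.splits)

lemma act_closed: "b \<in> boundaries n \<Longrightarrow> act n w b \<in> boundaries n"
  by (induction w arbitrary: b) (auto intro: act_letter_closed)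

lemma gap_le_iff:
  assumes "0 < n"
  shows "m * int n \<le> int j \<longleftrightarrow> m \<le> int (j div n)"
proof
  assume "m * int n \<le> int j"
  then show "m \<le> int (j div n)"
    using zdiv_mono1[of "m * int n" "int j" "int n"] assms by (simp add: zdiv_int)
next
  assume "m \<le> int (j div n)"
  then have "m * int n \<le> int (j div n * n)" by (simp add: mult_right_mono)
  also have "\<dots> \<le> int j" by (simp only: of_nat_le_iff div_times_less_eq_dividend)
  finally show "m * int n \<le> int j" .
qed

lemma act_letter_cancel:
  assumes n: "0 < n" and b: "b \<in> boundaries n"
  shows "act_letter n (a, \<not> c) (act_letter n (a, c) b) = b"
proof (cases a)
  case 0
  then show ?thesis by (cases b) auto
next
  case (Suc j)
  show ?thesis
  proof (cases b)
    case (Gap m)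
    then show ?thesis
      using n by (cases c) (auto simp: Suc gap_le_iff)
  next
    case (Mid k ds)
    then show ?thesis
      using n b by (cases c) (auto simp: Suc gap_le_iff split: list.splits)
  qed
qed

lemma act_letter_rel:
  assumes n: "0 < n" and b: "b \<in> boundaries n" and ij: "i < j"
  shows "act_letter n (i, True) (act_letter n (j, True) b)
    = act_letter n (j + n, True) (act_letter n (i, True) b)"
proof -
  obtain l where j: "j = Suc l" using ij by (cases j) auto
  \<comment> \<open>After \<open>x_i\<close> the leaf \<open>l\<close> is leaf \<open>l + n\<close>,
    one window further on.\<close>
  have l: "int ((l + n) div n) = int (l div n) + 1"
    "(m + 1) * int n \<le> int l + int n \<longleftrightarrow> m \<le> int (l div n)" for m
    using n gap_le_iff[OF n, of m l] by (simp_all add: algebra_simps)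
  show ?thesis
  proof (cases i)
    case 0
    then show ?thesis
      using n by (cases b) (auto simp: j gap_le_iff l  split: list.splits)
  next
    case (Suc k)
    have kl0: "k div n \<le> l div n" using ij by (simp add: j Suc div_le_mono)
    then have kl: "int (k div n) \<le> int (l div n)" by simp
    have kl': "m \<le> int (l div n)" "m * int n \<le> int l + int n" if "m \<le> int (k div n)" for m
      using gap_le_iff[OF n, of m l] that kl by linarith+
    have kl'': "\<not> int (l div n) + 1 \<le> int (k div n)" using kl by linarith
    show ?thesis
      using n b ij by (cases b) (auto simp: j Suc gap_le_iff l kl0 kl' kl'' split: list.splits)
  qed
qed

text \<open>The action is thus an invariant of the group element: what a normal form does to
  boundaries constrains every word for the same element.\<close>

lemma act_pres_eq:
  assumes "pres_eq (thompson_relations (Suc n)) u v" and n: "0 < n" and "b \<in> boundaries n"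
  shows "act n u b = act n v b"
  using assms(1,3)
proof (induction arbitrary: b)
  case (cong u u' v v')
  then show ?case by (simp add: act_closed)
next
  case (cancel a c)
  then show ?case using act_letter_cancel[OF n] by simp
next
  case (rel u v)
  then show ?case using act_letter_rel[OF n] by (auto simp: thompson_relations_def)
qed auto

section \<open>Sides of boundaries and lower bounds for their changes\<close>

datatype side = Swallowed | Left | Right

text \<open>\<open>Left\<close> says that the pointer is left of the gap: \<open>Gap 0\<close> and
  \<open>Gap 1\<close> are the two ends of the window at the pointer.\<close>

fun side_of :: "boundary \<Rightarrow> side" where
  "side_of (Gap m) = (if m \<ge> 1 then Left else Right)"
| "side_of (Mid k ds) = Swallowed"

lemma side_of_eq:
  "side_of b = Left \<longleftrightarrow> (\<exists>m\<ge>1. b = Gap m)" "side_of b = Swallowed \<longleftrightarrow> (\<exists>k ds. b = Mid k ds)"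
  by (cases b; auto)+

fun side_changes :: "nat \<Rightarrow> nat word \<Rightarrow> boundary \<Rightarrow> nat" where
  "side_changes n [] b = 0"
| "side_changes n (s # w) b =
     of_bool (side_of (act_letter n s b) \<noteq> side_of b) + side_changes n w (act_letter n s b)"

lemma inj_on_act_letter:
  assumes n: "0 < n"
  shows "inj_on (act_letter n s) (boundaries n)"
proof (rule inj_on_inverseI)
  fix b assume "b \<in> boundaries n"
  then show "act_letter n (fst s, \<not> snd s) (act_letter n s b) = b"
    using act_letter_cancel[OF n, of b "fst s" "snd s"] by simp
qed

text \<open>The index bound of the finite generating set enters here. \<open>x_0\<close> carries
  only \<open>Gap 0\<close> over the pointer, its inverse only \<open>Gap 1\<close>. For
  \<open>j < n\<close> the split of leaf \<open>j\<close> frees only \<open>Mid j []\<close>, as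
  \<open>Gap 1\<close>, and its inverse swallows only \<open>Gap 1\<close>.\<close>

lemma side_change_unique:
  assumes "0 < n" "fst s \<le> n"
  obtains b0 where "\<And>b. side_of (act_letter n s b) \<noteq> side_of b \<Longrightarrow> b = b0"
proof
  fix b assume "side_of (act_letter n s b) \<noteq> side_of b"
  then show "b = (case s of (0, True) \<Rightarrow> Gap 0 | (0, False) \<Rightarrow> Gap 1
    | (Suc j, True) \<Rightarrow> Mid (int j) [] | (Suc j, False) \<Rightarrow> Gap 1)"
    using assms
    by (cases "(n, s, b)" rule: act_letter.cases)
      (auto simp: gap_le_iff split: if_splits list.splits bool.splits)
qed

text \<open>The first letter causes at most one change over all boundaries together. The induction
  goes on with the image of \<open>E\<close>, on which the letter is injective.\<close>

lemma sum_side_changes_le: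
  assumes n: "0 < n" and "finite E" "E \<subseteq> boundaries n" "fst ` set w \<subseteq> {..n}"
  shows "(\<Sum>b\<in>E. side_changes n w b) \<le> length w"
  using assms(2-)
proof (induction w arbitrary: E)
  case (Cons s w)
  let ?C = "{b \<in> E. side_of (act_letter n s b) \<noteq> side_of b}"
  have "fst s \<le> n" using Cons.prems by simp
  with n obtain b0 where "\<And>b. side_of (act_letter n s b) \<noteq> side_of b \<Longrightarrow> b = b0"
    by (rule side_change_unique) blast
  then have "?C \<subseteq> {b0}" by auto
  then have "card ?C \<le> 1" using card_mono[of "{b0}" ?C] by simp
  moreover have "(\<Sum>b\<in>E. of_bool (side_of (act_letter n s b) \<noteq> side_of b)) = card ?C"
    using Cons.prems by (simp add: Int_def)
  moreover have "(\<Sum>b\<in>E. side_changes n w (act_letter n s b)) = (\<Sum>b\<in>act_letter n s ` E. side_changes n w b)"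
    using inj_on_subset[OF inj_on_act_letter[OF n]] Cons.prems by (simp add: sum.reindex)
  moreover have "\<dots> \<le> length w"
    using Cons.prems by (intro Cons.IH) (auto intro: act_letter_closed)
  ultimately show ?case by (simp add: sum.distrib)
qed simp

lemma side_changes_pos:
  "side_of (act n w b) \<noteq> side_of b \<Longrightarrow> side_changes n w b \<ge> 1"
  by (induction w arbitrary: b) auto

text \<open>While the gap stays to the right of the pointer, everything beyond it is merely translated.\<close>

lemma side_changes_gap:
  assumes "0 < n" "fst ` set w \<subseteq> {..n}" "m \<ge> 1" "k \<ge> m * int n"
    and "side_of (act n w (Gap m)) = Left" "side_of (act n w (Mid k ds)) \<noteq> Swallowed"
  shows "side_changes n w (Gap m) \<ge> 2"
  using assms(2-)
proof (induction w arbitrary: m k)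
  case (Cons s w)
  show ?case
  proof (cases "side_of (act_letter n s (Gap m)) = Left")
    \<comment> \<open>Having left the side \<open>Left\<close>, the gap must return to it, which is
      a second change.\<close>
    case False
    then have "side_changes n w (act_letter n s (Gap m)) \<ge> 1"
      using Cons.prems by (intro side_changes_pos) auto
    with False Cons.prems show ?thesis by simp
  next
    case True
    then obtain m' where m': "m' \<ge> 1" "act_letter n s (Gap m) = Gap m'"
      by (auto simp: side_of_eq)
    obtain a c where s: "s = (a, c)" by fastforce
    have a: "a \<le> n" using Cons.prems s by auto
    have mn: "int n \<le> m * int n"
      using \<open>m \<ge> 1\<close> mult_right_mono[of 1 m "int n"] by simp
    \<comment> \<open>A letter of index at most \<open>n\<close> that keeps the gap at
      \<open>Left\<close> touches only leaves before it, so gap and \<open>Mid k ds\<close> move by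
      the same multiple of \<open>n\<close>. If this went on to the end, \<open>Mid k ds\<close>
      would stay swallowed.\<close>
    have "act_letter n s (Mid k ds) = Mid (k + (m' - m) * int n) ds"
    proof (cases a)
      case 0
      then show ?thesis using m' s by (cases c) auto
    next
      case (Suc j)
      have j: "\<not> m * int n \<le> int j" "j div n = 0" using a mn unfolding Suc by (linarith, simp)
      show ?thesis
      proof (cases c)
        case True
        then show ?thesis using m' j s Suc Cons.prems by (auto split: if_splits)
      next
        case False
        then have m2: "m' = m - 1" "m \<ge> 2" using m' j s Suc Cons.prems by (auto split: if_splits)
        then have "2 * int n \<le> m * int n" using mult_right_mono[of 2 m "int n"] by simp
        then have "int (j + n) < k" using a Cons.prems unfolding Suc by linarith
        then show ?thesis using False m2 s Suc by auto
      qed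
    qed
    moreover have "k + (m' - m) * int n \<ge> m' * int n" using Cons.prems by (simp add: algebra_simps)
    ultimately show ?thesis
      using Cons.IH[of m' "k + (m' - m) * int n"] Cons.prems m' by simp
  qed
qed simp

text \<open>The condition on \<open>d\<close> says that child \<open>d\<close> lies beyond the boundary inside its parent.\<close>

lemma side_changes_mid:
  assumes n: "0 < n" and "fst ` set w \<subseteq> {..n}"
    and "(k + int (sum_list ds)) mod int n + int d \<ge> int n" "d \<le> n" "set ds \<subseteq> {..n}"
    and "side_of (act n w (Mid k ds)) = Left" "side_of (act n w (Mid k (ds @ [d]))) \<noteq> Swallowed"
  shows "side_changes n w (Mid k ds) \<ge> 3"
  using assms(2-)
proof (induction w arbitrary: k ds)
  case (Cons s w)
  obtain a c where s: "s = (a, c)" by fastforce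
  have a: "a \<le> n" using Cons.prems s by auto
  show ?case
  proof (cases "side_of (act_letter n s (Mid k ds)) = Swallowed")
    case True
    then obtain k' ds' where k': "act_letter n s (Mid k ds) = Mid k' ds'"
      by (auto simp: side_of_eq)
    \<comment> \<open>While the boundary is swallowed, \<open>k\<close> changes by multiples of
      \<open>n\<close> or trades a digit with \<open>ds\<close>. So \<open>k + sum_list ds\<close>
      modulo \<open>n\<close> is invariant: it is the place in a window where the caret will be
      split.\<close>
    have "act_letter n s (Mid k (ds @ [d])) = Mid k' (ds' @ [d])
      \<and> (k' + int (sum_list ds')) mod int n = (k + int (sum_list ds)) mod int n \<and> set ds' \<subseteq> {..n}"
    proof (cases a)
      case 0
      then show ?thesis using k' s Cons.prems
        by (cases c) (auto simp: mod_eq_dvd_iff)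
    next
      case (Suc j)
      then show ?thesis using k' s Cons.prems
        by (cases c) (auto split: if_splits list.splits simp: algebra_simps mod_eq_dvd_iff)
    qed
    then show ?thesis using Cons.IH[of k' ds'] Cons.prems k' by simp
  next
    case False
    \<comment> \<open>Only the split of leaf \<open>k\<close> itself frees the boundary. It becomes
      \<open>Gap 1\<close>, with child \<open>d\<close> beyond it at \<open>j + d\<close>, so
      \<open>side_changes_gap\<close> adds two changes to this one.\<close>
    then obtain j where j: "s = (Suc j, True)" "k = int j" "ds = []"
      using s by (cases a; cases c) (auto split: if_splits list.splits)
    have "j < n" using a s j by auto
    moreover have "side_changes n w (Gap 1) \<ge> 2"
      using Cons.prems j \<open>j < n\<close> by (intro side_changes_gap[OF n, where k = "int j + int d" and ds = "[]"]) auto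
    ultimately show ?thesis by (simp add: j)
  qed
qed simp

section \<open>Forests and short words\<close>

abbreviation word_equiv :: "nat \<Rightarrow> nat word \<Rightarrow> nat word \<Rightarrow> bool" where
  "word_equiv n \<equiv> pres_eq (thompson_relations (Suc n))"

lemmas pres_eq_trans [trans] = pres_eq.trans

lemma pres_eq_append_left: "pres_eq R u v \<Longrightarrow> pres_eq R (w @ u) (w @ v)"
  by (rule pres_eq.cong[OF pres_eq.refl])

lemma pres_eq_append_right: "pres_eq R u v \<Longrightarrow> pres_eq R (u @ w) (v @ w)"
  by (rule pres_eq.cong[OF _ pres_eq.refl])

lemma pres_eq_Cons: "pres_eq R u v \<Longrightarrow> pres_eq R (s # u) (s # v)"
  using pres_eq_append_left[of R u v "[s]"] by simp

lemma swap_letters: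
  "i < j \<Longrightarrow> word_equiv n ((j, True) # (i, True) # w) ((i, True) # (j + n, True) # w)"
  using pres_eq_append_right[OF pres_eq.rel, of "[(j, True), (i, True)]" "[(i, True), (j + n, True)]"
      "thompson_relations (Suc n)" w]
  by (auto simp: thompson_relations_def)

lemma cancel_letters: "pres_eq R ((0, False) # (0, True) # w) w"
  using pres_eq_append_right[OF pres_eq.cancel, of R 0 False w] by simp

definition shift_word :: "nat \<Rightarrow> nat word \<Rightarrow> nat word" where
  "shift_word n = map (\<lambda>(j, b). (j + n, b))"

text \<open>A letter of smaller index passes through a positive word, each crossing adding
  \<open>n\<close> to the index crossed.\<close>

lemma move_left:
  assumes "\<And>s. s \<in> set w \<Longrightarrow> snd s \<and> i < fst s"
  shows "word_equiv n (w @ [(i, True)]) ((i, True) # shift_word n w)"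
  using assms
proof (induction w)
  case (Cons s w)
  obtain j where s: "s = (j, True)" "i < j" using Cons.prems[of s] by (cases s) auto
  have "word_equiv n ((j, True) # w @ [(i, True)]) ((j, True) # (i, True) # shift_word n w)"
    using Cons by (intro pres_eq_Cons) auto
  also have "word_equiv n \<dots> ((i, True) # (j + n, True) # shift_word n w)"
    using s by (intro swap_letters)
  finally show ?case using s by (simp add: shift_word_def)
qed (simp add: shift_word_def pres_eq.refl)

lemma conj_shift:
  assumes "\<And>s. s \<in> set w \<Longrightarrow> snd s \<and> 0 < fst s"
  shows "word_equiv n ((0, False) # w @ [(0, True)]) (shift_word n w)"
proof -
  have "word_equiv n ((0, False) # w @ [(0, True)]) ((0, False) # (0, True) # shift_word n w)"
    using assms by (intro pres_eq_Cons move_left)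
  also have "word_equiv n \<dots> (shift_word n w)" by (rule cancel_letters)
  finally show ?thesis .
qed

lemma move_across_shifts:
  "word_equiv n ((Suc i, True) # replicate a (0, True)) (replicate a (0, True) @ [(Suc (i + a * n), True)])"
proof (induction a arbitrary: i)
  case (Suc a)
  have "word_equiv n ((Suc i, True) # (0, True) # replicate a (0, True))
      ((0, True) # (Suc i + n, True) # replicate a (0, True))"
    by (intro swap_letters) simp
  also have "(0, True) # (Suc i + n, True) # replicate a (0, True)
      = (0, True) # ((Suc (i + n), True) # replicate a (0, True))" by simp
  also have "word_equiv n \<dots>
      ((0, True) # (replicate a (0, True) @ [(Suc (i + n + a * n), True)]))"
    using Suc by (intro pres_eq_Cons)
  finally show ?case by (simp add: algebra_simps)
qed (simp add: pres_eq.refl)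

lemma cancel_shifts:
  "word_equiv n (replicate a (0, False) @ replicate a (0, True)) []"
proof (induction a)
  case (Suc a)
  have "word_equiv n (replicate a (0, False) @ (0, False) # (0, True) # replicate a (0, True))
     (replicate a (0, False) @ replicate a (0, True))"
    by (intro pres_eq_append_left cancel_letters)
  also have "word_equiv n \<dots> []" using Suc by simp
  finally show ?case by (simp add: replicate_app_Cons_same)
qed (simp add: pres_eq.refl)

section \<open>Trees, their words and their costs\<close>

datatype tree = Leaf | Node "tree list"

fun full :: "nat \<Rightarrow> tree \<Rightarrow> bool" where
  "full n Leaf \<longleftrightarrow> True"
| "full n (Node ts) \<longleftrightarrow> length ts = Suc n \<and> (\<forall>t\<in>set ts. full n t)"

text \<open>The trees of a forest are grown from right to left, so each root still has its original
  position when its turn comes.\<close>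

fun tree_word :: "nat \<Rightarrow> tree \<Rightarrow> nat word" and forest_word :: "nat \<Rightarrow> tree list \<Rightarrow> nat word" where
  "tree_word k Leaf = []"
| "tree_word k (Node ts) = (Suc k, True) # forest_word k ts"
| "forest_word k [] = []"
| "forest_word k (t # ts) = forest_word (Suc k) ts @ tree_word k t"

text \<open>Child \<open>d\<close> of a node at position \<open>k\<close> sits at
  \<open>k + d\<close>, so \<open>n - k mod n\<close> is the first \<open>d\<close> beyond the next
  multiple of \<open>n\<close>. To grow a child from there on, the pointer must go one window to the
  right and come back, hence the 2.\<close>

fun tree_cost :: "nat \<Rightarrow> nat \<Rightarrow> tree \<Rightarrow> nat" and forest_cost :: "nat \<Rightarrow> nat \<Rightarrow> tree list \<Rightarrow> nat" where
  "tree_cost n k Leaf = 0"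
| "tree_cost n k (Node ts) =
     Suc (forest_cost n k ts + (if set (drop (n - k mod n) ts) \<subseteq> {Leaf} then 0 else 2))"
| "forest_cost n k [] = 0"
| "forest_cost n k (t # ts) = tree_cost n k t + forest_cost n (Suc k) ts"

lemma tree_word_letters:
  "s \<in> set (tree_word k t) \<Longrightarrow> snd s \<and> k < fst s"
  "s \<in> set (forest_word k ts) \<Longrightarrow> snd s \<and> k < fst s"
  by (induction k t and k ts rule: tree_word_forest_word.induct) auto

lemma shift_tree_word:
  "shift_word m (tree_word k t) = tree_word (k + m) t"
  "shift_word m (forest_word k ts) = forest_word (k + m) ts"
  by (induction k t and k ts rule: tree_word_forest_word.induct) (auto simp: shift_word_def)

text \<open>Each split shifts what follows by \<open>n\<close>; the cost does not see this.\<close>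

lemma tree_cost_periodic:
  "tree_cost n (k + n) t = tree_cost n k t"
  "forest_cost n (k + n) ts = forest_cost n k ts"
  by (induction n k t and n k ts rule: tree_cost_forest_cost.induct) auto

lemma forest_word_append:
  "forest_word k (ts @ us) = forest_word (k + length ts) us @ forest_word k ts"
  by (induction ts arbitrary: k) auto

lemma forest_cost_append:
  "forest_cost n k (ts @ us) = forest_cost n k ts + forest_cost n (k + length ts) us"
  by (induction ts arbitrary: k) auto

lemma forest_leaves:
  assumes "set ts \<subseteq> {Leaf}"
  shows "forest_word k ts = []" "forest_cost n k ts = 0"
  using assms by (induction ts arbitrary: k) auto

text \<open>By \<open>move_left\<close> read backwards, \<open>x_{i+1}\<close> passes the letters of
  \<open>vs\<close>, whose indices drop by \<open>n\<close>. It then stands before the words of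
  \<open>us\<close> and becomes the caret above them.\<close>

lemma merge_trees:
  assumes "length ts = i" "length us = Suc n"
  shows "word_equiv n ((Suc i, True) # forest_word 0 (ts @ us @ vs)) (forest_word 0 (ts @ Node us # vs))"
proof -
  have "word_equiv n (((Suc i, True) # shift_word n (forest_word (Suc i) vs)) @ forest_word i us @ forest_word 0 ts)
     ((forest_word (Suc i) vs @ [(Suc i, True)]) @ forest_word i us @ forest_word 0 ts)"
    by (intro pres_eq_append_right pres_eq.sym[OF move_left]) (use tree_word_letters in blast)
  then show ?thesis
    using assms by (simp add: forest_word_append shift_tree_word)
qed

lemma short_forest_word:
  assumes "\<And>t k. t \<in> set ts \<Longrightarrow> k < n \<Longrightarrow>
      \<exists>w. fst ` set w \<subseteq> {..n} \<and> length w = tree_cost n k t \<and> word_equiv n w (tree_word k t)"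
    and "k + length ts \<le> n"
  shows "\<exists>w. fst ` set w \<subseteq> {..n} \<and> length w = forest_cost n k ts \<and> word_equiv n w (forest_word k ts)"
  using assms
proof (induction ts arbitrary: k)
  case Nil
  then show ?case by (auto intro: pres_eq.refl)
next
  case (Cons t ts)
  obtain w where w: "fst ` set w \<subseteq> {..n}" "length w = tree_cost n k t" "word_equiv n w (tree_word k t)"
    using Cons.prems(1)[of t k] Cons.prems(2) by auto
  obtain v where v: "fst ` set v \<subseteq> {..n}" "length v = forest_cost n (Suc k) ts"
      "word_equiv n v (forest_word (Suc k) ts)"
    using Cons.IH[of "Suc k"] Cons.prems by auto
  show ?case using w v by (intro exI[of _ "v @ w"]) (auto intro: pres_eq.cong)
qed

text \<open>After the split of leaf \<open>k\<close> the first \<open>n - k\<close> children are in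
  the window at the pointer and the last \<open>k + 1\<close> start at position \<open>n\<close>.
  Unless they are leaves, the latter are grown by \<open>x_0^-1 v x_0\<close> with \<open>v\<close>
  a short word for them at position 0.\<close>

lemma short_tree_word:
  assumes "full n t" "k < n"
  shows "\<exists>w. fst ` set w \<subseteq> {..n} \<and> length w = tree_cost n k t \<and> word_equiv n w (tree_word k t)"
  using assms
proof (induction t arbitrary: k)
  case Leaf
  then show ?case by (auto intro: pres_eq.refl)
next
  case (Node ts)
  define us vs where "us = take (n - k) ts" and "vs = drop (n - k) ts"
  have ts: "ts = us @ vs" and len: "length us = n - k" "length vs = Suc k"
    using Node.prems by (auto simp: us_def vs_def)
  have sub: "set us \<subseteq> set ts" "set vs \<subseteq> set ts" by (auto simp: ts)
  obtain u where u: "fst ` set u \<subseteq> {..n}" "length u = forest_cost n k us"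
      "word_equiv n u (forest_word k us)"
    using short_forest_word[of us n k, OF Node.IH] Node.prems sub len by fastforce
  obtain v where v: "fst ` set v \<subseteq> {..n}" "length v = forest_cost n 0 vs"
      "word_equiv n v (forest_word 0 vs)"
    using short_forest_word[of vs n 0, OF Node.IH] Node.prems sub len by fastforce
  define v' where "v' = (if set vs \<subseteq> {Leaf} then [] else (0, False) # v @ [(0, True)])"
  have v': "word_equiv n v' (forest_word n vs)"
  proof (cases "set vs \<subseteq> {Leaf}")
    case True
    then show ?thesis by (simp add: v'_def forest_leaves pres_eq.refl)
  next
    case False
    have "word_equiv n ((0, False) # v @ [(0, True)]) ((0, False) # forest_word 0 vs @ [(0, True)])"
      using v by (intro pres_eq_Cons pres_eq_append_right)
    also have "word_equiv n \<dots> (shift_word n (forest_word 0 vs))"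
      using tree_word_letters by (intro conj_shift) blast
    finally show ?thesis using False by (simp add: v'_def shift_tree_word)
  qed
  have "tree_word k (Node ts) = (Suc k, True) # forest_word n vs @ forest_word k us"
    using Node.prems by (simp add: ts forest_word_append len)
  then have "word_equiv n ((Suc k, True) # v' @ u) (tree_word k (Node ts))"
    using v' u by (auto intro: pres_eq_Cons pres_eq.cong)
  moreover have "length ((Suc k, True) # v' @ u) = tree_cost n k (Node ts)"
    using Node.prems u v tree_cost_periodic(2)[of n 0 vs] forest_leaves(2)[of vs n 0]
    by (auto simp: v'_def vs_def[symmetric]) (auto simp: ts forest_cost_append len)
  moreover have "fst ` set ((Suc k, True) # v' @ u) \<subseteq> {..n}"
    using Node.prems u v by (auto simp: v'_def)
  ultimately show ?case by blast
qed

definition window :: "nat \<Rightarrow> tree list \<Rightarrow> bool" where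
  "window n ts \<longleftrightarrow> length ts = n \<and> (\<forall>t\<in>set ts. full n t)"

text \<open>The windows are treated from right to left with one \<open>x_0\<close> between
  neighbours; \<open>move_left\<close> collects these letters at the front.\<close>

lemma short_windows_word:
  assumes "\<forall>ts\<in>set Ws. window n ts" "Ws \<noteq> []"
  shows "\<exists>w. fst ` set w \<subseteq> {..n} \<and> length w = length Ws - 1 + sum_list (map (forest_cost n 0) Ws)
    \<and> word_equiv n w (replicate (length Ws - 1) (0, True) @ forest_word 0 (concat Ws))"
  using assms
proof (induction Ws)
  case (Cons ts Ws)
  obtain w where w: "fst ` set w \<subseteq> {..n}" "length w = forest_cost n 0 ts"
      "word_equiv n w (forest_word 0 ts)"
    using short_forest_word[of ts n 0] short_tree_word Cons.prems by (auto simp: window_def)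
  show ?case
  proof (cases "Ws = []")
    case True
    then show ?thesis using w by auto
  next
    case False
    let ?m = "length Ws - 1" and ?u = "forest_word 0 (concat Ws)"
    have m: "length Ws = Suc ?m" using False by (cases Ws) auto
    obtain v where v: "fst ` set v \<subseteq> {..n}"
        "length v = ?m + sum_list (map (forest_cost n 0) Ws)"
        "word_equiv n v (replicate ?m (0, True) @ ?u)"
      using Cons.IH Cons.prems False by auto
    have "word_equiv n (v @ [(0, True)] @ w) ((replicate ?m (0, True) @ ?u) @ [(0, True)] @ forest_word 0 ts)"
      by (intro pres_eq.cong v w pres_eq.refl)
    also have "(replicate ?m (0, True) @ ?u) @ [(0, True)] @ forest_word 0 ts
        = replicate ?m (0, True) @ (?u @ [(0, True)]) @ forest_word 0 ts" by simp
    also have "word_equiv n \<dots> (replicate ?m (0, True) @ ((0, True) # shift_word n ?u) @ forest_word 0 ts)"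
      using tree_word_letters by (intro pres_eq_append_left pres_eq_append_right move_left) blast
    also have "replicate ?m (0, True) @ ((0, True) # shift_word n ?u) @ forest_word 0 ts
        = replicate (length Ws) (0, True) @ forest_word 0 (concat (ts # Ws))"
    proof -
      have "replicate (length Ws) x = x # replicate ?m x" for x :: "nat \<times> bool"
        by (subst m) simp
      then show ?thesis
        using Cons.prems
        by (simp add: shift_tree_word forest_word_append window_def replicate_app_Cons_same)
    qed
    finally show ?thesis
      using v w m by (intro exI[of _ "v @ [(0, True)] @ w"]) auto
  qed
qed simp

section \<open>Carets and the lower bound\<close>

fun node_at :: "tree \<Rightarrow> nat list \<Rightarrow> bool" where
  "node_at Leaf ds \<longleftrightarrow> False"
| "node_at (Node ts) [] \<longleftrightarrow> True"
| "node_at (Node ts) (d # ds) \<longleftrightarrow> d < length ts \<and> node_at (ts ! d) ds"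

lemma node_at_Nil [simp]: "node_at t [] \<longleftrightarrow> t \<noteq> Leaf"
  by (cases t) auto

lemma node_at_prefix: "node_at t (ds @ es) \<Longrightarrow> node_at t ds"
  by (induction t ds rule: node_at.induct) (auto intro: ccontr)

lemma node_at_digits: "full n t \<Longrightarrow> node_at t ds \<Longrightarrow> set ds \<subseteq> {..n}"
  by (induction t ds rule: node_at.induct) (auto simp: less_Suc_eq_le)

lemma finite_node_at: "finite {ds. node_at t ds}"
proof (induction t)
  case (Node ts)
  have "{ds. node_at (Node ts) ds} \<subseteq> insert [] (\<Union>d<length ts. (#) d ` {ds. node_at (ts ! d) ds})"
  proof
    fix ds assume "ds \<in> {ds. node_at (Node ts) ds}"
    then show "ds \<in> insert [] (\<Union>d<length ts. (#) d ` {ds. node_at (ts ! d) ds})"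
      by (cases ds) auto
  qed
  moreover have "finite \<dots>" using Node by auto
  ultimately show ?case by (rule finite_subset)
qed simp

lemma full_tree_eqI:
  assumes "full n t" "full n t'" "\<And>ds. node_at t ds \<longleftrightarrow> node_at t' ds"
  shows "t = t'"
  using assms
proof (induction t arbitrary: t')
  case Leaf
  then show ?case using Leaf(3)[of "[]"] by simp
next
  case (Node ts)
  then obtain ts' where t': "t' = Node ts'" using Node.prems(3)[of "[]"] by (cases t') auto
  have "ts ! d = ts' ! d" if d: "d < length ts" for d
    using Node.prems(1,2) Node.prems(3)[of "d # ds" for ds] d
    by (intro Node.IH) (auto simp: t')
  then show ?case using Node.prems by (auto simp: t' intro: nth_equalityI)
qed

section \<open>The effect of forest words on boundaries\<close>

lemma act_fix_left:
  assumes "\<And>s. s \<in> set w \<Longrightarrow> snd s \<and> k < fst s"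
  shows "i < int k \<Longrightarrow> act n w (Mid i ds) = Mid i ds"
    and "m \<le> 0 \<Longrightarrow> act n w (Gap m) = Gap m"
proof -
  have *: "\<exists>j. s = (Suc j, True) \<and> k \<le> j" if "s \<in> set w" for s
    using assms[OF that] by (cases s; cases "fst s") auto
  show "act n w (Mid i ds) = Mid i ds" if "i < int k"
    using *
  proof (induction w)
    case (Cons s w)
    obtain j where "s = (Suc j, True)" "k \<le> j" using Cons.prems[of s] by auto
    then show ?case using Cons that by simp
  qed simp
  assume m: "m \<le> 0"
  then have m': "m * int n \<le> int j" for j
    using mult_nonpos_nonneg[of m "int n"] by linarith
  show "act n w (Gap m) = Gap m"
    using *
  proof (induction w)
    case (Cons s w)
    obtain j where "s = (Suc j, True)" using Cons.prems[of s] by auto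
    then show ?case using Cons m' by simp
  qed simp
qed

lemma act_keeps_left:
  assumes "\<And>s. s \<in> set w \<Longrightarrow> snd s \<and> k < fst s" and "side_of b = Left"
  shows "side_of (act n w b) = Left"
  using assms
proof (induction w arbitrary: b)
  case (Cons s w)
  obtain j where s: "s = (Suc j, True)"
    using Cons.prems(1)[of s] by (cases s; cases "fst s") auto
  obtain m where "m \<ge> 1" "b = Gap m" using Cons.prems(2) by (auto simp: side_of_eq)
  then have "side_of (act_letter n s b) = Left" by (simp add: s)
  then show ?case using Cons by simp
qed simp

lemma act_beyond_tree:
  "full n t \<Longrightarrow> int k < i \<Longrightarrow> \<exists>i'\<ge>i. act n (tree_word k t) (Mid i ds) = Mid i' ds"
  "\<forall>t\<in>set ts. full n t \<Longrightarrow> int (k + length ts) \<le> i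
    \<Longrightarrow> \<exists>i'\<ge>i. act n (forest_word k ts) (Mid i ds) = Mid i' ds"
proof (induction k t and k ts arbitrary: i and i rule: tree_word_forest_word.induct)
  case (2 k ts)
  have "\<exists>i'\<ge>i + int n. act n (forest_word k ts) (Mid (i + int n) ds) = Mid i' ds"
    using 2(2,3) by (intro 2(1)) auto
  then obtain i' where "i' \<ge> i + int n" "act n (forest_word k ts) (Mid (i + int n) ds) = Mid i' ds"
    by blast
  then show ?case using 2 by (intro exI[of _ i']) auto
next
  case (4 k t ts)
  have "\<exists>i'\<ge>i. act n (forest_word (Suc k) ts) (Mid i ds) = Mid i' ds"
    using 4(3,4) by (intro 4(1)) auto
  then obtain i' where i': "i' \<ge> i" "act n (forest_word (Suc k) ts) (Mid i ds) = Mid i' ds"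
    by blast
  moreover have "\<exists>i''\<ge>i'. act n (tree_word k t) (Mid i' ds) = Mid i'' ds"
    using 4(3,4) i' by (intro 4(2)) auto
  then obtain i'' where "i'' \<ge> i'" "act n (tree_word k t) (Mid i' ds) = Mid i'' ds"
    by blast
  ultimately show ?case by (intro exI[of _ i'']) auto
qed auto

text \<open>The bound on \<open>i\<close> keeps a boundary that is not freed out of reach of the
  trees further left, which are grown later.\<close>

definition settled :: "nat \<Rightarrow> bool \<Rightarrow> boundary \<Rightarrow> bool" where
  "settled k c b \<longleftrightarrow> (if c then side_of b = Left else \<exists>i ds. int k \<le> i \<and> b = Mid i ds)"

text \<open>Growing the tree consumes addresses digit by digit: the split of a node frees its own
  boundary and hands each boundary inside child \<open>d\<close> over to position
  \<open>k + d\<close>. So exactly the boundaries at carets of the tree are freed.\<close>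

lemma act_tree_word:
  assumes n: "0 < n"
  shows "full n t \<Longrightarrow> settled k (node_at t ds) (act n (tree_word k t) (Mid (int k) ds))"
    and "\<forall>t\<in>set ts. full n t \<Longrightarrow> d < length ts
      \<Longrightarrow> settled (k + d) (node_at (ts ! d) ds) (act n (forest_word k ts) (Mid (int (k + d)) ds))"
proof (induction k t and k ts arbitrary: ds and d ds rule: tree_word_forest_word.induct)
  case (1 k)
  then show ?case by (simp add: settled_def)
next
  case (2 k ts)
  show ?case
  proof (cases ds)
    case Nil
    have "side_of (act n (forest_word k ts) (Gap (int (k div n) + 1))) = Left"
      using tree_word_letters(2) by (intro act_keeps_left) auto
    then show ?thesis by (simp add: Nil settled_def)
  next
    case (Cons d ds')
    show ?thesis
    proof (cases "d < length ts")
      case True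
      then have "settled (k + d) (node_at (ts ! d) ds') (act n (forest_word k ts) (Mid (int (k + d)) ds'))"
        using 2(1)[of d ds'] 2(2) by auto
      then show ?thesis using True by (auto simp: Cons settled_def)
    next
      case False
      then obtain i where "i \<ge> int (k + d)" "act n (forest_word k ts) (Mid (int (k + d)) ds') = Mid i ds'"
        using act_beyond_tree(2)[of ts n k "int (k + d)" ds'] 2 by auto
      then show ?thesis using False by (auto simp: Cons settled_def)
    qed
  qed
next
  case (3 k)
  then show ?case by simp
next
  case (4 k t ts)
  show ?case
  proof (cases d)
    case 0
    have "act n (forest_word (Suc k) ts) (Mid (int k) ds) = Mid (int k) ds"
      using tree_word_letters(2) by (intro act_fix_left(1)) auto
    then show ?thesis using 4 by (simp add: 0)
  next
    case (Suc e)
    define b where "b = act n (forest_word (Suc k) ts) (Mid (int (Suc k + e)) ds)"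
    have b: "settled (Suc k + e) (node_at (ts ! e) ds) b"
      unfolding b_def using 4 Suc by (intro 4(1)) auto
    have "settled (k + d) (node_at (ts ! e) ds) (act n (tree_word k t) b)"
    proof (cases "node_at (ts ! e) ds")
      case True
      then show ?thesis
        using b act_keeps_left[of "tree_word k t" k b n] tree_word_letters(1)[of _ k t]
        by (auto simp: settled_def)
    next
      case False
      then obtain i es where i: "int (Suc k + e) \<le> i" "b = Mid i es"
        using b by (auto simp: settled_def)
      then obtain i' where "i' \<ge> i" "act n (tree_word k t) (Mid i es) = Mid i' es"
        using act_beyond_tree(1)[of n t k i es] 4 by auto
      then show ?thesis using False i Suc by (auto simp: settled_def)
    qed
    then show ?thesis by (simp add: Suc b_def)
  qed
qed

text \<open>A list stands for an infinite forest with only leaves from some point on.\<close>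

definition tree_nth :: "tree list \<Rightarrow> nat \<Rightarrow> tree" where
  "tree_nth ts i = (if i < length ts then ts ! i else Leaf)"

lemma side_of_act_forest_word:
  assumes "0 < n" "\<forall>t\<in>set ts. full n t"
  shows "side_of (act n (forest_word 0 ts) (Mid (int i) ds))
    = (if node_at (tree_nth ts i) ds then Left else Swallowed)"
proof (cases "i < length ts")
  case True
  then show ?thesis
    using act_tree_word(2)[OF assms True, of 0 ds] by (auto simp: settled_def tree_nth_def)
next
  case False
  then show ?thesis
    using act_beyond_tree(2)[OF assms(2), of 0 "int i" ds] by (auto simp: tree_nth_def)
qed

lemma forest_cost_eq_sum: "forest_cost n k ts = (\<Sum>i<length ts. tree_cost n (k + i) (ts ! i))"
  by (induction ts arbitrary: k) (auto simp: sum.lessThan_Suc_shift simp del: sum.lessThan_Suc)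

text \<open>The caret at address \<open>ds\<close> accounts for 1 or 3 in \<open>tree_cost\<close>,
  according to its place \<open>(k + sum_list ds) mod n\<close> in a window. \<open>N\<close> will
  count the side changes of its boundary.\<close>

lemma tree_cost_le_sum:
  fixes N :: "nat list \<Rightarrow> nat"
  assumes "full n t" "\<And>ds. node_at t ds \<Longrightarrow> N ds \<ge> 1"
    and "\<And>ds d. node_at t (ds @ [d]) \<Longrightarrow> (k + sum_list ds) mod n + d \<ge> n \<Longrightarrow> N ds \<ge> 3"
  shows "tree_cost n k t \<le> (\<Sum>ds | node_at t ds. N ds)"
  using assms
proof (induction t arbitrary: k N)
  case (Node ts)
  have "tree_cost n (k + d) (ts ! d) \<le> (\<Sum>ds | node_at (ts ! d) ds. N (d # ds))" if d: "d < length ts" for d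
  proof (rule Node.IH)
    show "full n (ts ! d)" using Node.prems(1) d by simp
    show "1 \<le> N (d # ds)" if "node_at (ts ! d) ds" for ds
      using Node.prems(2)[of "d # ds"] that d by simp
    show "3 \<le> N (d # ds)" if "node_at (ts ! d) (ds @ [e])" "n \<le> (k + d + sum_list ds) mod n + e" for ds e
      using Node.prems(3)[of "d # ds" e] that d by (simp add: add.assoc)
  qed (use d in simp)
  then have "forest_cost n k ts \<le> (\<Sum>d<length ts. \<Sum>ds | node_at (ts ! d) ds. N (d # ds))"
    unfolding forest_cost_eq_sum by (intro sum_mono) auto
  also have "\<dots> = (\<Sum>d<length ts. sum N ((#) d ` {ds. node_at (ts ! d) ds}))"
    by (simp add: sum.reindex)
  also have "\<dots> = sum N (\<Union>d<length ts. (#) d ` {ds. node_at (ts ! d) ds})"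
    by (rule sum.UNION_disjoint[symmetric]) (auto simp: finite_node_at)
  finally have 1: "forest_cost n k ts \<le> \<dots>" .
  have "{ds. node_at (Node ts) ds} = insert [] (\<Union>d<length ts. (#) d ` {ds. node_at (ts ! d) ds})"
    (is "_ = insert [] ?U")
  proof -
    have "node_at (Node ts) ds \<longleftrightarrow> ds \<in> insert [] ?U" for ds by (cases ds) auto
    then show ?thesis by blast
  qed
  moreover have "finite ?U" "[] \<notin> ?U" by (auto simp: finite_node_at)
  ultimately have 2: "(\<Sum>ds | node_at (Node ts) ds. N ds) = N [] + sum N ?U" by simp
  have "N [] \<ge> (if set (drop (n - k mod n) ts) \<subseteq> {Leaf} then 1 else 3)"
  proof (cases "set (drop (n - k mod n) ts) \<subseteq> {Leaf}")
    case True
    then show ?thesis using Node.prems(2)[of "[]"] by simp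
  next
    case False
    then obtain d where d: "n - k mod n \<le> d" "d < length ts" "ts ! d \<noteq> Leaf"
      by (force simp: in_set_conv_nth)
    then show ?thesis using Node.prems(3)[of "[]" d] False by simp
  qed
  then show ?case using 1 2 by (auto split: if_splits)
qed simp

section \<open>Normal forms and their exact length\<close>

definition trimmed :: "nat \<Rightarrow> tree list list set" where
  "trimmed n = {Ws \<in> lists (Collect (window n)). Ws = [] \<or> last Ws \<noteq> replicate n Leaf}"

text \<open>The components are the windows left of the pointer, the one at the pointer, and those to
  its right without trailing trivial ones. The exponent of \<open>x_0\<close> is the length of the
  first.\<close>

definition normal_forms :: "nat \<Rightarrow> (tree list list \<times> tree list \<times> tree list list) set" where
  "normal_forms n = lists (Collect (window n)) \<times> Collect (window n) \<times> trimmed n"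

fun nf_word :: "tree list list \<times> tree list \<times> tree list list \<Rightarrow> nat word" where
  "nf_word (Ls, ts, Rs) = replicate (length Ls) (0, True) @ forest_word 0 (concat (Ls @ ts # Rs))"

definition windows_cost :: "nat \<Rightarrow> nat \<Rightarrow> tree list list \<Rightarrow> nat" where
  "windows_cost n c Ws = sum_list (map (\<lambda>ts. c + forest_cost n 0 ts) Ws)"

text \<open>The pointer starts at \<open>ts\<close> and ends at the first window. It travels once
  over the windows of \<open>Ls\<close> and twice over those of \<open>Rs\<close>, hence the
  surcharges 1 and 2.\<close>

fun nf_cost :: "nat \<Rightarrow> tree list list \<times> tree list \<times> tree list list \<Rightarrow> nat" where
  "nf_cost n (Ls, ts, Rs) = windows_cost n 1 Ls + (forest_cost n 0 ts + windows_cost n 2 Rs)"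

lemma windows_cost_altdef: "windows_cost n c Ws = c * length Ws + windows_cost n 0 Ws"
  by (induction Ws) (auto simp: windows_cost_def)

lemma windows_cost_append: "windows_cost n c (Ws @ Ws') = windows_cost n c Ws + windows_cost n c Ws'"
  by (simp add: windows_cost_def)

lemma windows_concat:
  assumes "\<forall>ts\<in>set Ws. window n ts"
  shows "length (concat Ws) = n * length Ws" "forest_cost n 0 (concat Ws) = windows_cost n 0 Ws"
    "\<forall>t\<in>set (concat Ws). full n t"
proof -
  show "length (concat Ws) = n * length Ws" "\<forall>t\<in>set (concat Ws). full n t"
    using assms by (induction Ws) (auto simp: window_def)
  show "forest_cost n 0 (concat Ws) = windows_cost n 0 Ws"
    using assms tree_cost_periodic(2)[of n 0]
    by (induction Ws) (auto simp: window_def windows_cost_def forest_cost_append)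
qed

lemma normal_forms_windows:
  assumes "(Ls, ts, Rs) \<in> normal_forms n"
  shows "\<forall>us\<in>set (Ls @ ts # Rs). window n us"
  using assms by (auto simp: normal_forms_def trimmed_def)

text \<open>Go to the last window by \<open>x_0^-1\<close>, then sweep to the first one as in
  \<open>short_windows_word\<close>. The inverse letters cancel all but \<open>length Ls\<close> of
  the letters \<open>x_0\<close>.\<close>

lemma short_nf_word:
  assumes "d \<in> normal_forms n"
  shows "\<exists>w. fst ` set w \<subseteq> {..n} \<and> length w = nf_cost n d \<and> word_equiv n w (nf_word d)"
proof -
  obtain Ls ts Rs where d: "d = (Ls, ts, Rs)" by (cases d)
  let ?Ws = "Ls @ ts # Rs" and ?l = "length Ls" and ?r = "length Rs"
  let ?x = "(0 :: nat, True)"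
  obtain w where w: "fst ` set w \<subseteq> {..n}"
      "length w = length ?Ws - 1 + sum_list (map (forest_cost n 0) ?Ws)"
      "word_equiv n w (replicate (length ?Ws - 1) ?x @ forest_word 0 (concat ?Ws))"
    using short_windows_word[of ?Ws n] normal_forms_windows assms unfolding d by blast
  have "word_equiv n (replicate ?r (0, False) @ w)
      (replicate ?r (0, False) @ replicate (length ?Ws - 1) ?x @ forest_word 0 (concat ?Ws))"
    using w by (intro pres_eq_append_left)
  also have "\<dots> = (replicate ?r (0, False) @ replicate ?r ?x) @ replicate ?l ?x @ forest_word 0 (concat ?Ws)"
    by (simp add: add.commute[of ?l] replicate_add)
  also have "word_equiv n \<dots> ([] @ replicate ?l ?x @ forest_word 0 (concat ?Ws))"
    by (intro pres_eq_append_right cancel_shifts)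
  finally have "word_equiv n (replicate ?r (0, False) @ w) (nf_word d)" by (simp add: d)
  moreover have "length (replicate ?r (0, False) @ w) = nf_cost n d"
    using w(2) windows_cost_altdef[of n 1 Ls] windows_cost_altdef[of n 2 Rs]
    by (simp add: d) (simp add: windows_cost_def)
  moreover have "fst ` set (replicate ?r (0, False) @ w) \<subseteq> {..n}" using w(1) by auto
  ultimately show ?thesis by blast
qed

lemma act_shifts:
  "(act_letter n (0, True) ^^ a) (Gap m) = Gap (m + int a)"
  "(act_letter n (0, True) ^^ a) (Mid k ds) = Mid (k + int a * int n) ds"
  by (induction a) (auto simp: algebra_simps)

text \<open>This tree in the last window forces the pointer to travel that far, and it lets the
  number of windows be read off the element.\<close>

lemma trimmed_node:
  assumes "Ws @ Rs \<noteq> []" "\<forall>ts\<in>set (Ws @ Rs). window n ts" "Rs \<in> trimmed n" "Rs \<noteq> []"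
  obtains i where "(length Ws + length Rs - 1) * n \<le> i" "i < length (concat (Ws @ Rs))"
    "concat (Ws @ Rs) ! i \<noteq> Leaf"
proof -
  define us where "us = last Rs"
  have Rs: "Rs = butlast Rs @ [us]" using assms(4) by (simp add: us_def)
  have us: "length us = n" "us \<noteq> replicate n Leaf"
    using assms Rs by (auto simp: trimmed_def window_def us_def)
  then obtain j where j: "j < n" "us ! j \<noteq> Leaf"
    by (metis length_replicate nth_equalityI nth_replicate)
  define xs where "xs = concat (Ws @ butlast Rs)"
  have c: "concat (Ws @ Rs) = xs @ us" unfolding xs_def by (subst Rs) simp
  have "length xs = n * length (Ws @ butlast Rs)"
    unfolding xs_def using assms(2) by (intro windows_concat) (auto dest: in_set_butlastD)
  moreover have "length (Ws @ butlast Rs) = length Ws + length Rs - 1"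
    using assms(4) by (cases Rs) auto
  ultimately show ?thesis
    using j us by (intro that[of "length xs + j"]) (simp_all only: c, auto simp: nth_append)
qed

text \<open>Three disjoint families of boundaries pay for the cost: the gaps left of the pointer
  that change over to its right (1 each), the gaps to its right that must be crossed and crossed
  back (2 each), and the boundaries at the carets.\<close>

lemma nf_cost_le:
  assumes n: "0 < n" and d: "d \<in> normal_forms n"
    and w: "fst ` set w \<subseteq> {..n}" "word_equiv n w (nf_word d)"
  shows "nf_cost n d \<le> length w"
proof -
  obtain Ls us Rs where dd: "d = (Ls, us, Rs)" by (cases d)
  define ts where "ts = concat (Ls @ us # Rs)"
  define a where "a = length Ls"
  note windows = normal_forms_windows[OF d[unfolded dd]]
  have full: "\<forall>t\<in>set ts. full n t" unfolding ts_def using windows by (rule windows_concat)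
  \<comment> \<open>Forest positions count from the first window, boundary positions from the
    pointer, \<open>a\<close> windows further on.\<close>
  let ?mid = "\<lambda>i. Mid (int i - int a * int n)" and ?N = "side_changes n w"
  have act_w: "act n w b = act n (forest_word 0 ts) (act n (replicate a (0, True)) b)"
    if "b \<in> boundaries n" for b
    using act_pres_eq[OF w(2) n that] by (simp add: dd a_def ts_def)
  have side_mid: "side_of (act n w (?mid i ds)) = Left"
    if "i < length ts" "node_at (ts ! i) ds" for i ds
  proof -
    have "set ds \<subseteq> {..n}" using that full by (intro node_at_digits[of n "ts ! i"]) auto
    then show ?thesis
      using that side_of_act_forest_word[OF n full, of i ds] act_w[of "?mid i ds"]
      by (simp add: act_shifts tree_nth_def)
  qed
  have side_gap: "side_of (act n w (Gap m)) = Left" if "m + int a \<ge> 1" for m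
    using that act_keeps_left[of "forest_word 0 ts" 0 "Gap (m + int a)" n] tree_word_letters(2)
    by (simp add: act_w act_shifts)
  define G1 G2 where "G1 = Gap ` {1 - int a..0}" and "G2 = Gap ` {1..int (length Rs)}"
  define M where "M = (\<Union>i<length ts. ?mid i ` {ds. node_at (ts ! i) ds})"
  have "(\<Sum>b\<in>G1. 1) \<le> sum ?N G1"
    using side_gap by (intro sum_mono side_changes_pos) (auto simp: G1_def)
  then have S1: "a \<le> sum ?N G1" by (simp add: G1_def card_image inj_on_def)
  have "(\<Sum>b\<in>G2. 2) \<le> sum ?N G2"
  proof (intro sum_mono)
    fix b assume "b \<in> G2"
    then obtain m where m: "1 \<le> m" "m \<le> int (length Rs)" "b = Gap m" by (auto simp: G2_def)
    then have "Rs \<noteq> []" by auto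
    \<comment> \<open>This tree lies beyond all gaps of \<open>G2\<close>. Its root boundary must be
      freed although each gap ends at \<open>Left\<close>, as \<open>side_changes_gap\<close>
      requires.\<close>
    then obtain i where i: "(length (Ls @ [us]) + length Rs - 1) * n \<le> i" "i < length ts" "ts ! i \<noteq> Leaf"
      using trimmed_node[of "Ls @ [us]" Rs n] windows d
      by (auto simp: ts_def dd normal_forms_def)
    have "m * int n \<le> int (length Rs) * int n" using m by (simp add: mult_right_mono)
    also have "\<dots> = int ((a + length Rs) * n) - int a * int n" by (simp add: algebra_simps)
    also have "int ((a + length Rs) * n) \<le> int i"
      using i(1) by (simp only: of_nat_le_iff) (simp add: a_def)
    finally show "2 \<le> ?N b"
      using side_gap[of m] side_mid[of i "[]"] m i unfolding m(3)
      by (intro side_changes_gap[OF n w(1), of _ _ "[]"]) auto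
  qed
  then have S2: "2 * length Rs \<le> sum ?N G2" by (simp add: G2_def card_image inj_on_def)
  have "tree_cost n (0 + i) (ts ! i) \<le> (\<Sum>ds | node_at (ts ! i) ds. ?N (?mid i ds))"
    if i: "i < length ts" for i
  proof (rule tree_cost_le_sum)
    show "full n (ts ! i)" using full i by simp
    show "1 \<le> ?N (?mid i ds)" if "node_at (ts ! i) ds" for ds
      using side_mid[OF i that] by (intro side_changes_pos) simp
    fix ds e assume e: "node_at (ts ! i) (ds @ [e])" "n \<le> (0 + i + sum_list ds) mod n + e"
    have "set (ds @ [e]) \<subseteq> {..n}" using e(1) full i by (intro node_at_digits[of n "ts ! i"]) auto
    moreover have "(int i - int a * int n + int (sum_list ds)) mod int n = int ((i + sum_list ds) mod n)"
      by (simp add: of_nat_mod mod_eq_dvd_iff algebra_simps flip: of_nat_add)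
    ultimately show "3 \<le> ?N (?mid i ds)"
      using e side_mid[OF i] node_at_prefix[OF e(1)]
      by (intro side_changes_mid[OF n w(1), of _ _ e]) auto
  qed
  then have "forest_cost n 0 ts \<le> (\<Sum>i<length ts. \<Sum>ds | node_at (ts ! i) ds. ?N (?mid i ds))"
    unfolding forest_cost_eq_sum by (intro sum_mono) auto
  also have "\<dots> = (\<Sum>i<length ts. sum ?N (?mid i ` {ds. node_at (ts ! i) ds}))"
    by (simp add: sum.reindex inj_on_def)
  also have "\<dots> = sum ?N M"
    unfolding M_def by (rule sum.UNION_disjoint[symmetric]) (auto simp: finite_node_at)
  finally have S3: "forest_cost n 0 ts \<le> sum ?N M" .
  have fin: "finite G1" "finite G2" "finite M"
    by (auto simp: G1_def G2_def M_def finite_node_at)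
  have "M \<subseteq> boundaries n"
    using full node_at_digits[of n] by (fastforce simp: M_def)
  then have "sum ?N (G1 \<union> G2 \<union> M) \<le> length w"
    using fin by (intro sum_side_changes_le[OF n]) (auto simp: G1_def G2_def w)
  also have "sum ?N (G1 \<union> G2 \<union> M) = sum ?N G1 + sum ?N G2 + sum ?N M"
    using fin by (subst sum.union_disjoint; (subst sum.union_disjoint)?) (auto simp: G1_def G2_def M_def)
  finally have "a + 2 * length Rs + forest_cost n 0 ts \<le> length w" using S1 S2 S3 by linarith
  moreover have "forest_cost n 0 ts = windows_cost n 0 (Ls @ us # Rs)"
    unfolding ts_def using windows by (rule windows_concat)
  ultimately show ?thesis
    using windows_cost_altdef[of n 1 Ls] windows_cost_altdef[of n 2 Rs]
    by (simp add: dd a_def windows_cost_append) (simp add: windows_cost_def)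
qed

section \<open>Normal forms of positive elements\<close>

lemma split_windows:
  assumes "length ts = m * n" "\<forall>t\<in>set ts. full n t"
  shows "\<exists>Ws. length Ws = m \<and> (\<forall>us\<in>set Ws. window n us) \<and> concat Ws = ts"
  using assms
proof (induction m arbitrary: ts)
  case (Suc m)
  obtain Ws where "length Ws = m" "\<forall>us\<in>set Ws. window n us" "concat Ws = drop n ts"
    using Suc.IH[of "drop n ts"] Suc.prems by (auto dest: in_set_dropD)
  then show ?case
    using Suc.prems by (intro exI[of _ "take n ts # Ws"]) (auto simp: window_def dest: in_set_takeD)
qed simp

lemma trim_windows:
  assumes "\<forall>us\<in>set Rs. window n us"
  shows "\<exists>Rs'\<in>trimmed n. \<forall>Vs. forest_word 0 (concat (Vs @ Rs')) = forest_word 0 (concat (Vs @ Rs))"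
  using assms
proof (induction Rs rule: rev_induct)
  case Nil
  show ?case by (intro bexI[of _ "[]"]) (auto simp: trimmed_def)
next
  case (snoc us Rs)
  show ?case
  proof (cases "us = replicate n Leaf")
    case True
    then have "forest_word 0 (concat (Vs @ Rs @ [us])) = forest_word 0 (concat (Vs @ Rs))" for Vs
      using forest_word_append[of 0 "concat (Vs @ Rs)" us] by (simp add: forest_leaves(1) set_replicate_conv_if)
    then show ?thesis using snoc by auto
  next
    case False
    then show ?thesis using snoc.prems by (intro bexI[of _ "Rs @ [us]"]) (auto simp: trimmed_def)
  qed
qed

lemma ex_normal_form:
  assumes n: "0 < n" and ts: "\<forall>t\<in>set ts. full n t"
  shows "\<exists>d\<in>normal_forms n. nf_word d = replicate a (0, True) @ forest_word 0 ts"
proof -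
  \<comment> \<open>Enough windows to hold \<open>ts\<close> and to have one at index
    \<open>a\<close>; the remaining places are filled with leaves.\<close>
  define m where "m = Suc (a + length ts)"
  have "length ts \<le> m * n" using n by (cases n) (auto simp: m_def)
  then have l: "length (ts @ replicate (m * n - length ts) Leaf) = m * n" by simp
  have "\<forall>t\<in>set (ts @ replicate (m * n - length ts) Leaf). full n t" using ts by auto
  from split_windows[OF l this] obtain Ws where
    Ws: "length Ws = m" "\<forall>us\<in>set Ws. window n us" "concat Ws = ts @ replicate (m * n - length ts) Leaf"
    by blast
  have a: "a < length Ws" by (simp add: Ws m_def)
  obtain Rs where Rs: "Rs \<in> trimmed n"
      "\<And>Vs. forest_word 0 (concat (Vs @ Rs)) = forest_word 0 (concat (Vs @ drop (Suc a) Ws))"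
    using trim_windows[of "drop (Suc a) Ws" n] Ws(2) by (auto dest: in_set_dropD)
  have "forest_word 0 (concat ((take a Ws @ [Ws ! a]) @ Rs)) = forest_word 0 (concat Ws)"
    unfolding Rs using id_take_nth_drop[OF a] by simp
  also have "\<dots> = forest_word 0 ts"
    unfolding Ws(3) forest_word_append by (simp add: forest_leaves(1) set_replicate_conv_if)
  finally have "nf_word (take a Ws, Ws ! a, Rs) = replicate a (0, True) @ forest_word 0 ts"
    using a by (simp add: min_absorb2)
  moreover have "(take a Ws, Ws ! a, Rs) \<in> normal_forms n"
    using Rs Ws a by (auto simp: normal_forms_def dest: in_set_takeD)
  ultimately show ?thesis by blast
qed

text \<open>\<open>x_0\<close> raises the exponent. A letter \<open>x_{j+1}\<close> passes
  \<open>x_0^a\<close>, its index growing by \<open>a * n\<close>, and then joins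
  \<open>n + 1\<close> consecutive trees under a new caret.\<close>

lemma nf_word_Cons:
  assumes n: "0 < n" and d: "d \<in> normal_forms n"
  shows "\<exists>d'\<in>normal_forms n. word_equiv n ((i, True) # nf_word d) (nf_word d')"
proof -
  obtain Ls us Rs where dd: "d = (Ls, us, Rs)" by (cases d)
  define ts where "ts = concat (Ls @ us # Rs)"
  define a where "a = length Ls"
  have full: "\<forall>t\<in>set ts. full n t"
    unfolding ts_def by (rule windows_concat(3)[OF normal_forms_windows[OF d[unfolded dd]]])
  have w: "nf_word d = replicate a (0, True) @ forest_word 0 ts" by (simp add: dd a_def ts_def)
  show ?thesis
  proof (cases i)
    case 0
    obtain d' where "d' \<in> normal_forms n" "nf_word d' = replicate (Suc a) (0, True) @ forest_word 0 ts"
      using ex_normal_form[OF n full] by blast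
    then show ?thesis
      by (intro bexI[of _ d']) (simp_all add: w 0 pres_eq.refl)
  next
    case (Suc j)
    define k where "k = j + a * n"
    define xs where "xs = ts @ replicate (k + Suc n) Leaf"
    define xs' where "xs' = take k xs @ Node (take (Suc n) (drop k xs)) # drop (k + Suc n) xs"
    have xs: "forest_word 0 xs = forest_word 0 ts" "\<forall>t\<in>set xs. full n t" "k + Suc n \<le> length xs"
      using full by (auto simp: xs_def forest_word_append forest_leaves(1) set_replicate_conv_if)
    have "xs = take k xs @ take (Suc n) (drop k xs) @ drop (k + Suc n) xs"
      by (metis add.commute append_take_drop_id drop_drop)
    then have merge: "word_equiv n ((Suc k, True) # forest_word 0 xs) (forest_word 0 xs')"
      using merge_trees[of "take k xs" k "take (Suc n) (drop k xs)" n "drop (k + Suc n) xs"] xs(3)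
      unfolding xs'_def by simp
    have "word_equiv n (((Suc j, True) # replicate a (0, True)) @ forest_word 0 ts)
        ((replicate a (0, True) @ [(Suc k, True)]) @ forest_word 0 ts)"
      unfolding k_def by (intro pres_eq_append_right move_across_shifts)
    also have "\<dots> = replicate a (0, True) @ ((Suc k, True) # forest_word 0 xs)" by (simp add: xs)
    also have "word_equiv n \<dots> (replicate a (0, True) @ forest_word 0 xs')"
      using merge by (rule pres_eq_append_left)
    finally have "word_equiv n ((i, True) # nf_word d) (replicate a (0, True) @ forest_word 0 xs')"
      by (simp add: Suc w)
    moreover have "\<forall>t\<in>set xs'. full n t"
      using xs by (auto simp: xs'_def dest!: in_set_takeD in_set_dropD)
    ultimately show ?thesis using ex_normal_form[OF n, of xs' a] by metis
  qed
qed

text \<open>The action recovers all data: far to the left it is translation by the exponent of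
  \<open>x_0\<close>, the freed boundaries are the carets, and trimming fixes the number of
  windows.\<close>

lemma nf_word_inj:
  assumes n: "0 < n" and d: "d \<in> normal_forms n" and d': "d' \<in> normal_forms n"
    and eq: "word_equiv n (nf_word d) (nf_word d')"
  shows "d = d'"
proof -
  obtain Ls us Rs where dd: "d = (Ls, us, Rs)" by (cases d)
  obtain Ls' us' Rs' where dd': "d' = (Ls', us', Rs')" by (cases d')
  define ts where "ts = concat (Ls @ us # Rs)"
  define ts' where "ts' = concat (Ls' @ us' # Rs')"
  note windows = normal_forms_windows[OF d[unfolded dd]] normal_forms_windows[OF d'[unfolded dd']]
  have full: "\<forall>t\<in>set ts. full n t" "\<forall>t\<in>set ts'. full n t"
    unfolding ts_def ts'_def by (rule windows_concat(3)[OF windows(1)], rule windows_concat(3)[OF windows(2)])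
  have act: "act n (forest_word 0 ts) ((act_letter n (0, True) ^^ length Ls) b)
      = act n (forest_word 0 ts') ((act_letter n (0, True) ^^ length Ls') b)"
    if "b \<in> boundaries n" for b
    using act_pres_eq[OF eq n that] by (simp add: dd dd' ts_def ts'_def)
  have fixed: "act n (forest_word 0 vs) (Gap (- int m)) = Gap (- int m)" for vs m
    using tree_word_letters(2)[of _ 0 vs] by (intro act_fix_left(2)) auto
  \<comment> \<open>After either shift this gap still has index at most 0, where forest words fix
    it, so only the two shifts are compared.\<close>
  have a: "length Ls = length Ls'"
    using act[of "Gap (- int (length Ls) - int (length Ls'))"]
      fixed[of ts "length Ls'"] fixed[of ts' "length Ls"]
    by (simp add: act_shifts)
  have trees: "tree_nth ts i = tree_nth ts' i" for i
  proof (rule full_tree_eqI)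
    show full_i: "full n (tree_nth ts i)" "full n (tree_nth ts' i)"
      using full by (auto simp: tree_nth_def)
    fix ds
    show "node_at (tree_nth ts i) ds \<longleftrightarrow> node_at (tree_nth ts' i) ds"
    proof (cases "set ds \<subseteq> {..n}")
      case True
      then show ?thesis
        using act[of "Mid (int i - int (length Ls) * int n) ds"] a
          side_of_act_forest_word[OF n full(1), of i ds] side_of_act_forest_word[OF n full(2), of i ds]
        by (simp add: act_shifts split: if_splits)
    next
      case False
      then show ?thesis using node_at_digits[OF full_i(1)] node_at_digits[OF full_i(2)] by blast
    qed
  qed
  \<comment> \<open>If \<open>Rs2\<close> were longer, some tree of its last window other than a
    leaf would lie beyond the whole first forest. General lists allow use in both
    directions.\<close>
  have len: "length Rs2 \<le> length Rs1"
    if shape: "length Ls1 = length Ls2" "\<forall>vs\<in>set (Ls1 @ us1 # Rs1). window n vs"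
      "\<forall>vs\<in>set (Ls2 @ us2 # Rs2). window n vs" "Rs2 \<in> trimmed n"
      "\<And>i. tree_nth (concat (Ls1 @ us1 # Rs1)) i = tree_nth (concat (Ls2 @ us2 # Rs2)) i"
    for Ls1 Ls2 us1 us2 Rs1 Rs2
  proof (rule ccontr)
    assume less: "\<not> length Rs2 \<le> length Rs1"
    then have "Rs2 \<noteq> []" by auto
    obtain i where i: "(length (Ls2 @ [us2]) + length Rs2 - 1) * n \<le> i"
        "i < length (concat ((Ls2 @ [us2]) @ Rs2))" "concat ((Ls2 @ [us2]) @ Rs2) ! i \<noteq> Leaf"
      by (rule trimmed_node[of "Ls2 @ [us2]" Rs2 n]) (use shape(3,4) \<open>Rs2 \<noteq> []\<close> in auto)
    have "length (concat (Ls1 @ us1 # Rs1)) = length (Ls1 @ us1 # Rs1) * n"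
      using windows_concat(1)[OF shape(2)] by (simp only: mult.commute)
    also have "\<dots> \<le> (length (Ls2 @ [us2]) + length Rs2 - 1) * n"
      using less shape(1) by (intro mult_right_mono) auto
    also have "\<dots> \<le> i" by (rule i)
    finally have "tree_nth (concat (Ls1 @ us1 # Rs1)) i = Leaf" by (simp add: tree_nth_def)
    moreover have "tree_nth (concat (Ls2 @ us2 # Rs2)) i \<noteq> Leaf"
      using i by (simp add: tree_nth_def)
    ultimately show False using shape(5) by simp
  qed
  have "Rs \<in> trimmed n" "Rs' \<in> trimmed n" using d d' by (auto simp: dd dd' normal_forms_def)
  then have r: "length Rs = length Rs'"
    using len[OF a windows(1) windows(2)] len[OF a[symmetric] windows(2) windows(1)] trees
    unfolding ts_def ts'_def by (intro antisym) auto
  have l: "length ts = length ts'"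
    using windows_concat(1)[OF windows(1)] windows_concat(1)[OF windows(2)] a r
    unfolding ts_def ts'_def by simp
  then have "ts = ts'"
    using trees unfolding tree_nth_def by (intro nth_equalityI) (simp, metis)
  moreover have "length x = length y" if "(x, y) \<in> set (zip (Ls @ us # Rs) (Ls' @ us' # Rs'))" for x y
    using that windows by (metis set_zip_leftD set_zip_rightD window_def)
  ultimately have "Ls @ us # Rs = Ls' @ us' # Rs'"
    using a r unfolding ts_def ts'_def
    by (subst (asm) concat_eq_concat_iff) auto
  then show ?thesis using a by (simp add: dd dd')
qed

section \<open>From words to group elements\<close>

abbreviation word_class :: "nat \<Rightarrow> nat word \<Rightarrow> nat word set" where
  "word_class p u \<equiv> pres_rel (thompson_relations p) `` {u}"

lemma word_class_eq_iff: "word_class (Suc n) u = word_class (Suc n) v \<longleftrightarrow> word_equiv n u v"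
  by (rule pres_class_eq_iff)

lemma thompson_simps:
  "\<one>\<^bsub>thompson p\<^esub> = word_class p []"
  "word_class p u \<otimes>\<^bsub>thompson p\<^esub> word_class p v = word_class p (u @ v)"
  by (simp_all add: thompson_def presented_group_mult) (simp add: presented_group_def)

lemma list_mult_letters: "list_mult (thompson p) (map (\<lambda>s. word_class p [s]) w) = word_class p w"
  by (induction w) (simp_all add: list_mult_def thompson_simps)

lemma inv_thompson_gen: "inv\<^bsub>thompson p\<^esub> (thompson_gen p i) = word_class p [(i, False)]"
proof -
  interpret group "thompson p" by (rule group_thompson)
  have "word_class p [(i, False)] \<otimes>\<^bsub>thompson p\<^esub> thompson_gen p i = \<one>\<^bsub>thompson p\<^esub>"
    using pres_eq.cancel[of "thompson_relations p" i False]
    by (simp add: thompson_gen_def pres_gen_def thompson_simps pres_class_eq_iff)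
  then show ?thesis
    by (intro inv_equality thompson_gen_closed) (simp_all add: thompson_def pres_class_in_carrier)
qed

lemma word_length_word_class:
  "word_length (thompson (Suc n)) (thompson_gen (Suc n) ` {0..<Suc n}) (word_class (Suc n) u)
    = (LEAST m. \<exists>w. fst ` set w \<subseteq> {..n} \<and> length w = m \<and> word_equiv n w u)"
proof -
  let ?p = "Suc n" and ?f = "\<lambda>s. word_class (Suc n) [s]"
  let ?X = "thompson_gen ?p ` {0..<?p} \<union> m_inv (thompson ?p) ` thompson_gen ?p ` {0..<?p}"
  have X: "?X = ?f ` {s. fst s \<le> n}"
  proof -
    have "{s. fst s \<le> n} = (\<lambda>i. (i, True)) ` {0..<?p} \<union> (\<lambda>i. (i, False)) ` {0..<?p}"
      by (auto simp: image_iff less_Suc_eq_le)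
    then show ?thesis
      by (simp add: image_Un image_image inv_thompson_gen) (simp add: thompson_gen_def pres_gen_def)
  qed
  have "(\<exists>gs. set gs \<subseteq> ?X \<and> length gs = m \<and> list_mult (thompson ?p) gs = word_class ?p u)
    \<longleftrightarrow> (\<exists>w. fst ` set w \<subseteq> {..n} \<and> length w = m \<and> word_equiv n w u)" (is "?L \<longleftrightarrow> ?R") for m
  proof
    assume ?L
    then obtain gs where gs: "gs \<in> lists (?f ` {s. fst s \<le> n})" "length gs = m"
        "list_mult (thompson ?p) gs = word_class ?p u"
      unfolding X by auto
    then obtain w where "gs = map ?f w" "w \<in> lists {s. fst s \<le> n}"
      by (auto simp: lists_image)
    then show ?R using gs by (auto simp: list_mult_letters word_class_eq_iff)
  next
    assume ?R
    then obtain w where "fst ` set w \<subseteq> {..n}" "length w = m" "word_equiv n w u" by blast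
    then show ?L
      unfolding X
      by (intro exI[of _ "map ?f w"]) (auto simp: list_mult_letters word_class_eq_iff)
  qed
  then show ?thesis unfolding word_length_def by simp
qed

lemma word_length_nf:
  assumes n: "0 < n" and d: "d \<in> normal_forms n"
  shows "word_length (thompson (Suc n)) (thompson_gen (Suc n) ` {0..<Suc n}) (word_class (Suc n) (nf_word d))
    = nf_cost n d"
  unfolding word_length_word_class
  using short_nf_word[OF d] nf_cost_le[OF n d] by (intro Least_equality) auto

text \<open>A product of generators is brought into normal form from its right end by
  \<open>nf_word_Cons\<close>; conversely, a normal form has only positive letters.\<close>

lemma thompson_pos_eq:
  assumes n: "0 < n"
  shows "thompson_pos (Suc n) = (\<lambda>d. word_class (Suc n) (nf_word d)) ` normal_forms n"
proof (intro subset_antisym subsetI)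
  fix g assume "g \<in> thompson_pos (Suc n)"
  then obtain gs where gs: "set gs \<subseteq> range (thompson_gen (Suc n))" "g = list_mult (thompson (Suc n)) gs"
    by (auto simp: thompson_pos_def)
  from gs(1) have "\<exists>d\<in>normal_forms n. list_mult (thompson (Suc n)) gs = word_class (Suc n) (nf_word d)"
  proof (induction gs)
    case Nil
    then show ?case
      using ex_normal_form[OF n, of "[]" 0] by (auto simp del: nf_word.simps simp: list_mult_def thompson_simps) metis
  next
    case (Cons x gs)
    then obtain i d where d: "d \<in> normal_forms n" "x = word_class (Suc n) [(i, True)]"
        "list_mult (thompson (Suc n)) gs = word_class (Suc n) (nf_word d)"
      by (auto simp: thompson_gen_def pres_gen_def)
    then have "list_mult (thompson (Suc n)) (x # gs) = word_class (Suc n) ((i, True) # nf_word d)"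
      by (simp add: list_mult_def thompson_simps)
    then show ?case using nf_word_Cons[OF n d(1), of i] by (simp add: word_class_eq_iff)
  qed
  then show "g \<in> (\<lambda>d. word_class (Suc n) (nf_word d)) ` normal_forms n" using gs by auto
next
  fix g assume "g \<in> (\<lambda>d. word_class (Suc n) (nf_word d)) ` normal_forms n"
  then obtain d where g: "g = word_class (Suc n) (nf_word d)" by blast
  have "snd s" if "s \<in> set (nf_word d)" for s
    using that by (cases d) (auto dest: tree_word_letters(2) split: if_splits)
  then have "set (map (\<lambda>s. word_class (Suc n) [s]) (nf_word d)) \<subseteq> range (thompson_gen (Suc n))"
    by (fastforce simp: thompson_gen_def pres_gen_def)
  then show "g \<in> thompson_pos (Suc n)"
    unfolding thompson_pos_def g using list_mult_letters[of "Suc n" "nf_word d"] by blast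
qed

lemma pos_count_eq:
  assumes n: "0 < n"
  shows "pos_count (Suc n) m = card {d \<in> normal_forms n. nf_cost n d = m}"
proof -
  let ?f = "\<lambda>d. word_class (Suc n) (nf_word d)"
  have "{g \<in> thompson_pos (Suc n). word_length (thompson (Suc n)) (thompson_gen (Suc n) ` {0..<Suc n}) g = m}
      = ?f ` {d \<in> normal_forms n. nf_cost n d = m}"
    using word_length_nf[OF n] by (auto simp: thompson_pos_eq[OF n])
  moreover have "inj_on ?f {d \<in> normal_forms n. nf_cost n d = m}"
    using nf_word_inj[OF n] by (auto simp: inj_on_def word_class_eq_iff)
  ultimately show ?thesis by (simp add: pos_count_def card_image)
qed

section \<open>Generating functions\<close>

text \<open>\<open>card\<close> of an infinite set is 0, so the sum and product formulas for
  \<open>gen_fun\<close> rely on this.\<close>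

definition finite_fibres :: "'a set \<Rightarrow> ('a \<Rightarrow> nat) \<Rightarrow> bool" where
  "finite_fibres A w \<longleftrightarrow> (\<forall>m. finite {a \<in> A. w a = m})"

definition gen_fun :: "'a set \<Rightarrow> ('a \<Rightarrow> nat) \<Rightarrow> complex fps" where
  "gen_fun A w = Abs_fps (\<lambda>m. of_nat (card {a \<in> A. w a = m}))"

lemma finite_fibres_subset: "finite_fibres B w \<Longrightarrow> A \<subseteq> B \<Longrightarrow> finite_fibres A w"
  unfolding finite_fibres_def by (auto intro: finite_subset[of _ "{a \<in> B. w a = m}" for m])

lemma finite_fibres_shift: "finite_fibres A w \<Longrightarrow> finite_fibres A (\<lambda>a. c + w a)"
proof -
  assume *: "finite_fibres A w"
  have "{a \<in> A. c + w a = m} \<subseteq> {a \<in> A. w a = m - c}" for m by auto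
  with * show ?thesis unfolding finite_fibres_def by (meson finite_subset)
qed

lemma fibre_Times:
  "{x \<in> A \<times> B. (case x of (a, b) \<Rightarrow> w a + v b) = (m :: nat)}
    = (\<Union>i\<in>{0..m}. {a \<in> A. w a = i} \<times> {b \<in> B. v b = m - i})"
  by auto

lemma finite_fibres_Times:
  "finite_fibres A w \<Longrightarrow> finite_fibres B v \<Longrightarrow> finite_fibres (A \<times> B) (\<lambda>(a, b). w a + v b)"
  unfolding finite_fibres_def fibre_Times by auto

lemma gen_fun_Times:
  assumes "finite_fibres A w" "finite_fibres B v"
  shows "gen_fun (A \<times> B) (\<lambda>(a, b). w a + v b) = gen_fun A w * gen_fun B v"
proof (rule fps_ext)
  fix m
  have "card (\<Union>i\<in>{0..m}. {a \<in> A. w a = i} \<times> {b \<in> B. v b = m - i})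
      = (\<Sum>i=0..m. card ({a \<in> A. w a = i} \<times> {b \<in> B. v b = m - i}))"
    using assms by (intro card_UN_disjoint) (auto simp: finite_fibres_def)
  then show "fps_nth (gen_fun (A \<times> B) (\<lambda>(a, b). w a + v b)) m = fps_nth (gen_fun A w * gen_fun B v) m"
    unfolding gen_fun_def fps_mult_nth fps_nth_Abs_fps fibre_Times
    by (simp add: card_cartesian_product)
qed

lemma fibre_image: "{b \<in> f ` A. w b = m} = f ` {a \<in> A. w (f a) = m}"
  by auto

lemma finite_fibres_image: "finite_fibres A (\<lambda>a. w (f a)) \<Longrightarrow> finite_fibres (f ` A) w"
  unfolding finite_fibres_def fibre_image by auto

lemma gen_fun_image:
  assumes "inj_on f A"
  shows "gen_fun (f ` A) w = gen_fun A (\<lambda>a. w (f a))"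
proof -
  have "inj_on f {a \<in> A. w (f a) = m}" for m using assms by (rule inj_on_subset) auto
  then show ?thesis unfolding gen_fun_def fibre_image by (simp add: card_image)
qed

lemma gen_fun_Un:
  assumes "finite_fibres A w" "finite_fibres B w" "A \<inter> B = {}"
  shows "gen_fun (A \<union> B) w = gen_fun A w + gen_fun B w"
proof (rule fps_ext)
  fix m
  have "{a \<in> A \<union> B. w a = m} = {a \<in> A. w a = m} \<union> {a \<in> B. w a = m}" by auto
  moreover have "card ({a \<in> A. w a = m} \<union> {a \<in> B. w a = m})
      = card {a \<in> A. w a = m} + card {a \<in> B. w a = m}"
    using assms by (intro card_Un_disjoint) (auto simp: finite_fibres_def)
  ultimately show "fps_nth (gen_fun (A \<union> B) w) m = fps_nth (gen_fun A w + gen_fun B w) m"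
    by (simp add: gen_fun_def)
qed

lemma finite_fibres_singleton: "finite_fibres {a} w"
  by (simp add: finite_fibres_def)

lemma finite_fibres_insert:
  assumes "finite_fibres A w"
  shows "finite_fibres (insert a A) w"
proof -
  have "finite {b \<in> insert a A. w b = m}" for m
    by (rule finite_subset[of _ "insert a {b \<in> A. w b = m}"]) (use assms in \<open>auto simp: finite_fibres_def\<close>)
  then show ?thesis by (simp add: finite_fibres_def)
qed

lemma gen_fun_singleton: "gen_fun {a} w = fps_X ^ w a"
proof (rule fps_ext)
  fix m
  have "{b \<in> {a}. w b = m} = (if w a = m then {a} else {})" by auto
  then show "fps_nth (gen_fun {a} w) m = fps_nth (fps_X ^ w a) m"
    by (auto simp: gen_fun_def fps_X_power_nth)
qed

lemma gen_fun_insert: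
  assumes "finite_fibres A w" "a \<notin> A"
  shows "gen_fun (insert a A) w = fps_X ^ w a + gen_fun A w"
  using gen_fun_Un[OF finite_fibres_singleton assms(1), of a] assms(2) by (simp add: gen_fun_singleton)

lemma gen_fun_shift: "gen_fun A (\<lambda>a. c + w a) = fps_X ^ c * gen_fun A w"
proof (rule fps_ext)
  fix m
  have "{a \<in> A. c + w a = m} = (if m < c then {} else {a \<in> A. w a = m - c})" by auto
  then show "fps_nth (gen_fun A (\<lambda>a. c + w a)) m = fps_nth (fps_X ^ c * gen_fun A w) m"
    by (simp add: gen_fun_def fps_X_power_mult_nth)
qed

lemma gen_fun_cong:
  assumes "\<And>a. a \<in> A \<Longrightarrow> w a = v a"
  shows "gen_fun A w = gen_fun A v"
proof -
  have "{a \<in> A. w a = m} = {a \<in> A. v a = m}" for m using assms by auto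
  then show ?thesis by (simp add: gen_fun_def)
qed

lemma finite_bounded:
  assumes "finite_fibres A w"
  shows "finite {a \<in> A. w a \<le> m}"
proof -
  have "{a \<in> A. w a \<le> m} = (\<Union>i\<le>m. {a \<in> A. w a = i})" by auto
  then show ?thesis using assms by (auto simp: finite_fibres_def)
qed

lemma finite_fibres_lists:
  assumes "finite_fibres A w" "0 < c"
  shows "finite_fibres (lists A) (\<lambda>xs. sum_list (map (\<lambda>a. c + w a) xs))"
  unfolding finite_fibres_def
proof
  fix m
  have len: "length xs \<le> sum_list (map (\<lambda>a. c + w a) xs)" for xs
    using assms(2) by (induction xs) auto
  have elt: "w a \<le> sum_list (map (\<lambda>a. c + w a) xs)" if "a \<in> set xs" for a xs
    using member_le_sum_list[of "c + w a" "map (\<lambda>a. c + w a) xs"] that by auto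
  have "{xs \<in> lists A. sum_list (map (\<lambda>a. c + w a) xs) = m}
      \<subseteq> {xs. set xs \<subseteq> {a \<in> A. w a \<le> m} \<and> length xs \<le> m}"
    using len elt by auto
  moreover have "finite \<dots>" using finite_bounded[OF assms(1)] by (rule finite_lists_length_le)
  ultimately show "finite {xs \<in> lists A. sum_list (map (\<lambda>a. c + w a) xs) = m}" by (rule finite_subset)
qed

section \<open>Counting trees and forests by cost\<close>

lemma leaves_iff_replicate: "set ts \<subseteq> {Leaf} \<longleftrightarrow> ts = replicate (length ts) Leaf"
  by (induction ts) auto

text \<open>The root caret costs at least 1, so in a tree of cost at most \<open>Suc m\<close> the
  children have cost at most \<open>m\<close>, at the positions \<open>k\<close> to
  \<open>k + n\<close>.\<close>

lemma finite_full_trees: "finite {t. full n t \<and> tree_cost n k t \<le> m}"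
proof (induction m arbitrary: k)
  case 0
  have "{t. full n t \<and> tree_cost n k t \<le> 0} \<subseteq> {Leaf}"
  proof
    fix t assume "t \<in> {t. full n t \<and> tree_cost n k t \<le> 0}"
    then show "t \<in> {Leaf}" by (cases t) auto
  qed
  then show ?case by (rule finite_subset) simp
next
  case (Suc m)
  let ?A = "\<Union>i\<le>n. {t. full n t \<and> tree_cost n (k + i) t \<le> m}"
  have "{t. full n t \<and> tree_cost n k t \<le> Suc m} \<subseteq> insert Leaf (Node ` {ts. set ts \<subseteq> ?A \<and> length ts = Suc n})"
  proof
    fix t assume t: "t \<in> {t. full n t \<and> tree_cost n k t \<le> Suc m}"
    show "t \<in> insert Leaf (Node ` {ts. set ts \<subseteq> ?A \<and> length ts = Suc n})"
    proof (cases t)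
      case (Node ts)
      have "forest_cost n k ts \<le> m" using t Node by simp
      have "u \<in> ?A" if u: "u \<in> set ts" for u
      proof -
        obtain i where i: "i < length ts" "u = ts ! i" using u by (auto simp: in_set_conv_nth)
        have "tree_cost n (k + i) (ts ! i) \<le> forest_cost n k ts"
          unfolding forest_cost_eq_sum using i by (intro member_le_sum) auto
        then have "tree_cost n (k + i) u \<le> m" using \<open>forest_cost n k ts \<le> m\<close> i by simp
        moreover have "i \<le> n" "full n u" using t Node i u by auto
        ultimately show ?thesis by blast
      qed
      then show ?thesis using t Node by auto
    qed simp
  qed
  moreover have "finite {ts. set ts \<subseteq> ?A \<and> length ts = Suc n}"
    using Suc by (intro finite_lists_length_eq) auto
  ultimately show ?case by (meson finite.insertI finite_imageI finite_subset)
qed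

definition forests :: "nat \<Rightarrow> nat \<Rightarrow> tree list set" where
  "forests n l = {ts. length ts = l \<and> (\<forall>t\<in>set ts. full n t)}"

definition forest_gf :: "nat \<Rightarrow> nat \<Rightarrow> nat \<Rightarrow> complex fps" where
  "forest_gf n k l = gen_fun (forests n l) (forest_cost n k)"

lemma forests_append: "forests n (l + m) = (\<lambda>(ts, us). ts @ us) ` (forests n l \<times> forests n m)"
proof (intro subset_antisym subsetI)
  fix ts assume "ts \<in> forests n (l + m)"
  then show "ts \<in> (\<lambda>(ts, us). ts @ us) ` (forests n l \<times> forests n m)"
    by (intro image_eqI[of _ _ "(take l ts, drop l ts)"])
      (auto simp: forests_def dest: in_set_takeD in_set_dropD)
qed (auto simp: forests_def)

lemma inj_on_forests_append: "inj_on (\<lambda>(ts, us). ts @ us) (forests n l \<times> forests n m)"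
  by (auto simp: inj_on_def forests_def)

lemma forests_0: "forests n 0 = {[]}"
  by (auto simp: forests_def)

lemma forests_1: "forests n 1 = (\<lambda>t. [t]) ` {t. full n t}"
  by (auto simp: forests_def length_Suc_conv)

lemma finite_fibres_trees: "finite_fibres {t. full n t} (tree_cost n k)"
  unfolding finite_fibres_def
proof
  fix m
  show "finite {t \<in> {t. full n t}. tree_cost n k t = m}"
    using finite_full_trees[of n k m] by (rule finite_subset[rotated]) auto
qed

lemma finite_fibres_forests: "finite_fibres (forests n l) (forest_cost n k)"
proof (induction l arbitrary: k)
  case 0
  then show ?case by (simp add: forests_0 finite_fibres_singleton)
next
  case (Suc l)
  have "finite_fibres (forests n 1) (forest_cost n k)"
    unfolding forests_1 using finite_fibres_trees[of n k] by (intro finite_fibres_image) simp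
  from finite_fibres_Times[OF this Suc[of "Suc k"]]
  have "finite_fibres (forests n 1 \<times> forests n l) (\<lambda>x. forest_cost n k (case x of (ts, us) \<Rightarrow> ts @ us))"
    unfolding finite_fibres_def
    by (elim all_forward back_subst[of finite]) (auto simp: forests_def forest_cost_append)
  then show ?case using forests_append[of n 1 l] finite_fibres_image by simp
qed

lemma forest_gf_add: "forest_gf n k (l + m) = forest_gf n k l * forest_gf n (k + l) m"
proof -
  have "forest_gf n k (l + m) = gen_fun (forests n l \<times> forests n m) (\<lambda>(ts, us). forest_cost n k ts + forest_cost n (k + l) us)"
    unfolding forest_gf_def forests_append gen_fun_image[OF inj_on_forests_append]
    by (rule gen_fun_cong) (auto simp: forest_cost_append forests_def)
  then show ?thesis
    unfolding forest_gf_def by (simp add: gen_fun_Times finite_fibres_forests)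
qed

lemma forest_gf_0 [simp]: "forest_gf n k 0 = 1"
  by (simp add: forest_gf_def forests_0 gen_fun_singleton)

text \<open>A tree is a leaf or a caret. The first \<open>n - k\<close> children of a caret are in
  its window. The other \<open>k + 1\<close> start at place 0 of the next one and carry the factor
  X^2 unless all are leaves, the case counted by the inner summand 1.\<close>

lemma forest_gf_1:
  assumes "k < n"
  shows "forest_gf n k 1 = 1 + fps_X * (forest_gf n k (n - k) * (1 + fps_X\<^sup>2 * (forest_gf n 0 (Suc k) - 1)))"
proof -
  define z where "z = replicate (Suc k) Leaf"
  define A where "A = forests n (n - k)"
  define B where "B = forests n (Suc k)"
  define c where "c us = forest_cost n 0 us + (if set us \<subseteq> {Leaf} then 0 else 2)" for us
  have z: "set us \<subseteq> {Leaf} \<longleftrightarrow> us = z" if "us \<in> B" for us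
    using that leaves_iff_replicate[of us] by (simp add: B_def forests_def z_def)
  have zB: "z \<in> B" by (auto simp: B_def forests_def z_def)
  have "forest_cost n 0 z = 0" by (intro forest_leaves) (auto simp: z_def)
  have finB: "finite_fibres (B - {z}) (forest_cost n 0)"
    using finite_fibres_forests by (rule finite_fibres_subset) (auto simp: B_def)
  have Bz: "insert z (B - {z}) = B" using zB by auto
  have finc: "finite_fibres (B - {z}) c"
    using finite_fibres_shift[OF finB, of 2] z
    unfolding finite_fibres_def by (elim all_forward back_subst[of finite]) (auto simp: c_def)
  have "gen_fun (B - {z}) c = gen_fun (B - {z}) (\<lambda>us. 2 + forest_cost n 0 us)"
    using z by (intro gen_fun_cong) (auto simp: c_def)
  also have "\<dots> = fps_X\<^sup>2 * gen_fun (B - {z}) (forest_cost n 0)" by (rule gen_fun_shift)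
  finally have shifted: "gen_fun (B - {z}) c = fps_X\<^sup>2 * gen_fun (B - {z}) (forest_cost n 0)" .
  have "c z = 0" using z[OF zB] \<open>forest_cost n 0 z = 0\<close> by (simp only: c_def) simp
  then have "gen_fun B c = 1 + fps_X\<^sup>2 * gen_fun (B - {z}) (forest_cost n 0)"
    using gen_fun_insert[OF finc, of z] by (simp only: Bz shifted) simp
  moreover have "gen_fun B (forest_cost n 0) = 1 + gen_fun (B - {z}) (forest_cost n 0)"
    using gen_fun_insert[OF finB, of z] \<open>forest_cost n 0 z = 0\<close> by (simp only: Bz) simp
  ultimately have gB: "gen_fun B c = 1 + fps_X\<^sup>2 * (forest_gf n 0 (Suc k) - 1)"
    by (simp add: forest_gf_def B_def)
  have finBc: "finite_fibres B c" using finite_fibres_insert[OF finc, of z] by (simp only: Bz)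
  have trees: "{t. full n t} = insert Leaf ((\<lambda>(ts, us). Node (ts @ us)) ` (A \<times> B))"
  proof -
    have "Suc n = (n - k) + Suc k" using assms by simp
    then have "forests n (Suc n) = (\<lambda>(ts, us). ts @ us) ` (A \<times> B)"
      using forests_append[of n "n - k" "Suc k"] by (simp add: A_def B_def)
    moreover have "{t. full n t} = insert Leaf (Node ` forests n (Suc n))"
    proof -
      have "t \<in> {t. full n t} \<longleftrightarrow> t \<in> insert Leaf (Node ` forests n (Suc n))" for t
        by (cases t) (auto simp: forests_def)
      then show ?thesis by blast
    qed
    ultimately show ?thesis by (simp add: image_image case_prod_unfold)
  qed
  have inj: "inj_on (\<lambda>(ts, us). Node (ts @ us)) (A \<times> B)"
    using inj_on_forests_append[of n "n - k" "Suc k"] by (auto simp: inj_on_def A_def B_def)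
  have cost: "tree_cost n k (Node (ts @ us)) = 1 + (forest_cost n k ts + c us)" if "ts \<in> A" "us \<in> B" for ts us
    using that assms tree_cost_periodic(2)[of n 0 us]
    by (auto simp: A_def B_def forests_def c_def forest_cost_append)
  have "forest_gf n k 1 = gen_fun {t. full n t} (tree_cost n k)"
    unfolding forest_gf_def forests_1 by (subst gen_fun_image) (auto simp: inj_on_def)
  also have "\<dots> = 1 + gen_fun ((\<lambda>(ts, us). Node (ts @ us)) ` (A \<times> B)) (tree_cost n k)"
  proof -
    have "finite_fibres ((\<lambda>(ts, us). Node (ts @ us)) ` (A \<times> B)) (tree_cost n k)"
      using finite_fibres_trees by (rule finite_fibres_subset) (use trees in blast)
    then show ?thesis unfolding trees by (subst gen_fun_insert) auto
  qed
  also have "gen_fun ((\<lambda>(ts, us). Node (ts @ us)) ` (A \<times> B)) (tree_cost n k)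
      = gen_fun (A \<times> B) (\<lambda>x. 1 + (case x of (ts, us) \<Rightarrow> forest_cost n k ts + c us))"
    unfolding gen_fun_image[OF inj] by (rule gen_fun_cong) (use cost in auto)
  also have "\<dots> = fps_X * (gen_fun A (forest_cost n k) * gen_fun B c)"
    unfolding gen_fun_shift using finBc finite_fibres_forests by (subst gen_fun_Times) (auto simp: A_def)
  finally show ?thesis by (simp add: gB A_def forest_gf_def)
qed

text \<open>The quantity \<open>E k\<close> below is a fixed multiple of \<open>1 / A k - s\<close>, where \<open>s\<close> is the fixed point of the
  Moebius recursion \<open>1 / A (k + 1) = (1 / A k + X (1 - X\<^sup>2)) / q\<close> for the generating function \<open>A k\<close>
  of the forests rooted at \<open>k, \<dots>, n - 1\<close>.\<close>

lemma window_gf_equation: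
  fixes n :: nat
  defines "P \<equiv> forest_gf n 0 n"
  shows "(1 - fps_X ^ 3 * P) ^ n * (1 - fps_X\<^sup>2 + fps_X\<^sup>2 * P) = 1"
proof -
  define A where "A k = forest_gf n k (n - k)" for k
  define B where "B k = forest_gf n 0 k" for k
  define q where "q = 1 - fps_X ^ 3 * P"
  define E where "E k = fps_X\<^sup>2 * P * inverse (A k) + 1 - fps_X\<^sup>2" for k
  \<comment> \<open>The constant coefficient counts the forests of cost 0. Only the forest of leaves
    is one, so every \<open>A k\<close> is invertible.\<close>
  have "{ts \<in> forests n l. forest_cost n k ts = 0} = {replicate l Leaf}" for k l
  proof -
    have "tree_cost n k t = 0 \<Longrightarrow> t = Leaf" for k t by (cases t) auto
    then have "forest_cost n k ts = 0 \<Longrightarrow> set ts \<subseteq> {Leaf}" for k ts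
      by (induction ts arbitrary: k) auto
    then have "forest_cost n k ts = 0 \<longleftrightarrow> ts = replicate (length ts) Leaf" for k ts
      unfolding leaves_iff_replicate[symmetric] by (auto intro: forest_leaves)
    then show ?thesis by (auto simp: forests_def split: if_splits)
  qed
  then have unit: "fps_nth (A k) 0 \<noteq> 0" for k by (simp add: A_def forest_gf_def gen_fun_def)
  \<comment> \<open>The product is the same wherever the window is cut, which eliminates
    \<open>B\<close> from the recursion.\<close>
  have BA: "B k * A k = P" if "k \<le> n" for k
    using forest_gf_add[of n 0 k "n - k"] that by (simp add: A_def B_def P_def)
  have step: "q * E (Suc k) = E k" if k: "k < n" for k
  proof -
    define T where "T = forest_gf n k 1"
    have TA: "T * A (Suc k) = A k"
      using forest_gf_add[of n k 1 "n - Suc k"] k by (simp add: A_def T_def Suc_diff_Suc)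
    have TB: "B (Suc k) = B k * T"
      using forest_gf_add[of n 0 k 1] by (simp add: B_def T_def)
    have "T = 1 + fps_X * (A k * (1 + fps_X\<^sup>2 * (B (Suc k) - 1)))"
      unfolding T_def A_def B_def using k by (rule forest_gf_1)
    also have "\<dots> = 1 + fps_X * (1 - fps_X\<^sup>2) * A k + fps_X ^ 3 * (B k * A k) * T"
      by (simp add: TB algebra_simps power2_eq_square power3_eq_cube)
    finally have "T = 1 + fps_X * (1 - fps_X\<^sup>2) * A k + fps_X ^ 3 * P * T" using BA k by simp
    then have "T * q = 1 + fps_X * (1 - fps_X\<^sup>2) * A k" by (simp add: q_def algebra_simps)
    then have "A (Suc k) * (T * q) = A (Suc k) * (1 + fps_X * (1 - fps_X\<^sup>2) * A k)" by simp
    then have rec: "A k * q = A (Suc k) * (1 + fps_X * (1 - fps_X\<^sup>2) * A k)"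
      by (simp add: TA[symmetric] algebra_simps)
    \<comment> \<open>In the inverses the recursion is affine; \<open>E\<close> is chosen so that
      its constant term disappears.\<close>
    define u v where "u = inverse (A k)" and "v = inverse (A (Suc k))"
    have uv: "u * A k = 1" "v * A (Suc k) = 1"
      using unit by (simp_all add: u_def v_def inverse_mult_eq_1)
    have "u * v * (A k * q) = u * v * (A (Suc k) * (1 + fps_X * (1 - fps_X\<^sup>2) * A k))" using rec by simp
    then have "(u * A k) * v * q = (v * A (Suc k)) * (u + fps_X * (1 - fps_X\<^sup>2) * (u * A k))"
      by (simp add: algebra_simps)
    then have "v * q = u + fps_X * (1 - fps_X\<^sup>2)" by (simp add: uv)
    then have "fps_X\<^sup>2 * P * (v * q) = fps_X\<^sup>2 * P * (u + fps_X * (1 - fps_X\<^sup>2))" by simp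
    then show ?thesis
      unfolding E_def u_def[symmetric] v_def[symmetric] q_def
      by (simp add: algebra_simps power2_eq_square power3_eq_cube)
  qed
  have "q ^ k * E k = E 0" if "k \<le> n" for k
    using that
  proof (induction k)
    case (Suc k)
    then show ?case using step[of k] by (simp add: mult.assoc mult.commute[of q])
  qed simp
  then have "q ^ n * E n = E 0" by simp
  \<comment> \<open>The two ends of the chain are the whole window and the empty forest.\<close>
  moreover have A0: "A 0 = P" and An: "A n = 1" by (simp_all add: A_def P_def)
  moreover have "P * inverse P = 1" using unit[of 0] A0 by (simp add: inverse_mult_eq_1')
  then have "E 0 = 1" unfolding E_def A0 by (simp add: mult.assoc)
  moreover have "E n = 1 - fps_X\<^sup>2 + fps_X\<^sup>2 * P" unfolding E_def An by simp
  ultimately show ?thesis by (simp add: q_def)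
qed

section \<open>The generating function of the normal forms\<close>

lemma windows_eq_forests: "Collect (window n) = forests n n"
  by (auto simp: forests_def window_def)

lemma windows_gf: "gen_fun (Collect (window n)) (forest_cost n 0) = forest_gf n 0 n"
  by (simp add: forest_gf_def windows_eq_forests)

lemma finite_fibres_windows: "finite_fibres (Collect (window n)) (forest_cost n 0)"
  unfolding windows_eq_forests by (rule finite_fibres_forests)

lemma windows_cost_Cons: "windows_cost n c (ts # Ws) = c + forest_cost n 0 ts + windows_cost n c Ws"
  by (simp add: windows_cost_def)

lemma gen_fun_Cons:
  assumes "finite_fibres S (windows_cost n c)"
  shows "gen_fun ((\<lambda>(ts, Ws). ts # Ws) ` (Collect (window n) \<times> S)) (windows_cost n c)
    = fps_X ^ c * forest_gf n 0 n * gen_fun S (windows_cost n c)"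
proof -
  have "inj_on (\<lambda>(ts, Ws). ts # Ws) (Collect (window n) \<times> S)" by (auto simp: inj_on_def)
  then have "gen_fun ((\<lambda>(ts, Ws). ts # Ws) ` (Collect (window n) \<times> S)) (windows_cost n c)
      = gen_fun (Collect (window n) \<times> S) (\<lambda>(ts, Ws). (c + forest_cost n 0 ts) + windows_cost n c Ws)"
    by (simp add: gen_fun_image) (auto intro!: gen_fun_cong simp: windows_cost_Cons)
  also have "\<dots> = gen_fun (Collect (window n)) (\<lambda>ts. c + forest_cost n 0 ts) * gen_fun S (windows_cost n c)"
    using assms finite_fibres_windows finite_fibres_shift by (intro gen_fun_Times) auto
  finally show ?thesis by (simp add: gen_fun_shift windows_gf)
qed

lemma finite_fibres_window_lists:
  assumes "0 < c"
  shows "finite_fibres (lists (Collect (window n))) (windows_cost n c)"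
  using finite_fibres_lists[OF finite_fibres_windows assms] by (simp add: windows_cost_def[abs_def])

lemma window_lists_gf:
  "gen_fun (lists (Collect (window n))) (windows_cost n 1) * (1 - fps_X * forest_gf n 0 n) = 1"
proof -
  let ?S = "lists (Collect (window n))" and ?C = "\<lambda>(ts, Ws). ts # Ws"
  have eq: "?S = insert [] (?C ` (Collect (window n) \<times> ?S))"
  proof -
    have "Ws \<in> ?S \<longleftrightarrow> Ws \<in> insert [] (?C ` (Collect (window n) \<times> ?S))" for Ws
      by (cases Ws) auto
    then show ?thesis by blast
  qed
  have fin: "finite_fibres ?S (windows_cost n 1)" by (rule finite_fibres_window_lists) simp
  have "gen_fun ?S (windows_cost n 1) = 1 + gen_fun (?C ` (Collect (window n) \<times> ?S)) (windows_cost n 1)"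
    by (subst eq, subst gen_fun_insert)
      (use finite_fibres_subset[OF fin] eq in \<open>auto simp: windows_cost_def\<close>)
  also have "\<dots> = 1 + fps_X * forest_gf n 0 n * gen_fun ?S (windows_cost n 1)"
    using gen_fun_Cons[OF fin] by simp
  finally show ?thesis by (simp add: algebra_simps)
qed

text \<open>Prepending a window keeps a list trimmed, except for the trivial window before the empty
  list, which has weight X^2. This exception corrects the numerator of the geometric series to
  \<open>1 - X^2\<close>.\<close>

lemma trimmed_gf:
  "gen_fun (trimmed n) (windows_cost n 2) * (1 - fps_X\<^sup>2 * forest_gf n 0 n) = 1 - fps_X\<^sup>2"
proof -
  let ?z = "replicate n Leaf" and ?C = "\<lambda>(ts, Ws). ts # Ws"
  have z: "window n ?z" by (auto simp: window_def)
  have sub: "trimmed n \<subseteq> lists (Collect (window n))"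
    "?C ` (Collect (window n) \<times> trimmed n) \<subseteq> lists (Collect (window n))" by (auto simp: trimmed_def)
  have fin: "finite_fibres (trimmed n) (windows_cost n 2)"
    "finite_fibres (?C ` (Collect (window n) \<times> trimmed n)) (windows_cost n 2)"
    using sub by (blast intro: finite_fibres_subset[OF finite_fibres_window_lists[of 2]] zero_less_numeral)+
  have eq: "insert [?z] (trimmed n) = insert [] (?C ` (Collect (window n) \<times> trimmed n))"
  proof -
    have "Ws \<in> insert [?z] (trimmed n) \<longleftrightarrow> Ws \<in> insert [] (?C ` (Collect (window n) \<times> trimmed n))" for Ws
      using z by (cases Ws) (auto simp: trimmed_def)
    then show ?thesis by blast
  qed
  have "fps_X\<^sup>2 + gen_fun (trimmed n) (windows_cost n 2) = gen_fun (insert [?z] (trimmed n)) (windows_cost n 2)"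
  proof -
    have "forest_cost n 0 ?z = 0" by (intro forest_leaves(2)) auto
    then have "windows_cost n 2 [?z] = 2" by (simp add: windows_cost_def)
    moreover have "[?z] \<notin> trimmed n" by (simp add: trimmed_def)
    ultimately show ?thesis using gen_fun_insert[OF fin(1)] by metis
  qed
  also have "\<dots> = 1 + fps_X\<^sup>2 * forest_gf n 0 n * gen_fun (trimmed n) (windows_cost n 2)"
    unfolding eq using fin by (subst gen_fun_insert) (auto simp: gen_fun_Cons windows_cost_def)
  finally show ?thesis by (simp add: algebra_simps)
qed

text \<open>The components are independent and their costs add, so the series is the product of
  \<open>1 / (1 - X P)\<close>, \<open>P\<close> and \<open>(1 - X^2) / (1 - X^2 P)\<close>.\<close>

lemma normal_forms_gf:
  fixes n :: nat
  defines "P \<equiv> forest_gf n 0 n"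
  shows "gen_fun (normal_forms n) (nf_cost n) * ((1 - fps_X * P) * (1 - fps_X\<^sup>2 * P)) = P * (1 - fps_X\<^sup>2)"
proof -
  have fin: "finite_fibres (trimmed n) (windows_cost n 2)"
    by (rule finite_fibres_subset[OF finite_fibres_window_lists]) (auto simp: trimmed_def)
  have "gen_fun (normal_forms n) (nf_cost n) = gen_fun (normal_forms n)
      (\<lambda>(Ls, x). windows_cost n 1 Ls + (case x of (ts, Rs) \<Rightarrow> forest_cost n 0 ts + windows_cost n 2 Rs))"
    by (rule gen_fun_cong) auto
  also have "\<dots> = gen_fun (lists (Collect (window n))) (windows_cost n 1)
      * (P * gen_fun (trimmed n) (windows_cost n 2))"
    unfolding normal_forms_def P_def
    by (subst gen_fun_Times; (subst gen_fun_Times)?)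
      (simp_all add: fin finite_fibres_windows finite_fibres_window_lists finite_fibres_Times windows_gf)
  finally show ?thesis
    using window_lists_gf[of n] trimmed_gf[of n] unfolding P_def[symmetric]
    by (metis (no_types, lifting) mult.assoc mult.commute mult.left_neutral)
qed

section \<open>Irrationality\<close>

text \<open>A \<open>complex poly poly\<close> is an element of C[X][y]: the inner variable becomes
  \<open>fps_X\<close>, the outer one \<open>q\<close>.\<close>

definition eval_fps :: "complex poly poly \<Rightarrow> complex fps \<Rightarrow> complex fps" where
  "eval_fps g q = poly (map_poly fps_of_poly g) q"

lemma eval_fps_0 [simp]: "eval_fps 0 q = 0"
  by (simp add: eval_fps_def)

lemma eval_fps_pCons [simp]: "eval_fps (pCons a g) q = fps_of_poly a + q * eval_fps g q"
  by (simp add: eval_fps_def map_poly_pCons)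

lemma eval_fps_add [simp]: "eval_fps (g + h) q = eval_fps g q + eval_fps h q"
  by (induction g h rule: poly_induct2) (simp_all add: fps_of_poly_add algebra_simps)

lemma eval_fps_smult [simp]: "eval_fps (smult a g) q = fps_of_poly a * eval_fps g q"
  by (induction g) (simp_all add: fps_of_poly_mult algebra_simps)

lemma eval_fps_mult [simp]: "eval_fps (g * h) q = eval_fps g q * eval_fps h q"
  by (induction g) (simp_all add: algebra_simps)

lemma eval_fps_monom: "eval_fps (monom a m) q = fps_of_poly a * q ^ m"
  by (induction m) (simp_all add: monom_0 monom_Suc algebra_simps)

lemma eval_fps_diff [simp]: "eval_fps (g - h) q = eval_fps g q - eval_fps h q"
  using eval_fps_add[of "g - h" h q] by simp

lemma root_imp_degree_nonzero:
  assumes "p \<noteq> 0" "poly p a = 0"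
  shows "degree p \<noteq> 0"
proof
  assume "degree p = 0"
  then obtain c where "p = [:c:]" by (rule degree_eq_zeroE)
  then show False using assms by simp
qed

text \<open>Reduction modulo X of a polynomial in \<open>y\<close> over C[X].\<close>

definition at_0 :: "complex poly poly \<Rightarrow> complex poly" where
  "at_0 g = map_poly (\<lambda>a. poly a 0) g"

lemma coeff_at_0: "coeff (at_0 g) i = poly (coeff g i) 0"
  by (simp add: at_0_def coeff_map_poly)

lemma at_0_mult: "at_0 (g * h) = at_0 g * at_0 h"
  by (rule poly_eqI) (simp add: coeff_at_0 coeff_mult poly_sum)

lemma nth_0_eval_fps: "fps_nth (eval_fps g q) 0 = poly (at_0 g) (fps_nth q 0)"
  by (induction g) (simp_all add: at_0_def map_poly_pCons poly_0_coeff_0)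

lemma degree_at_0:
  assumes "poly (lead_coeff g) 0 \<noteq> 0"
  shows "degree (at_0 g) = degree g"
  using assms by (intro antisym degree_le le_degree) (auto simp: coeff_at_0 coeff_eq_0)

text \<open>Gauss's lemma: a monic \<open>f\<close> has content 1, so \<open>a\<close> equals the
  content of \<open>h\<close> up to a unit and cancels against it.\<close>

lemma primitive_dvd_monic:
  fixes f g h :: "complex poly poly"
  assumes "lead_coeff f = 1" "content g = 1" "a \<noteq> 0" "smult a f = g * h"
  shows "g dvd f"
proof -
  have "content f dvd 1" using content_dvd_coeff[of f "degree f"] assms(1) by simp
  then have "normalize (content f) = 1" by (rule is_unit_normalize)
  then have "content f = 1" by simp
  moreover have "content (smult a f) = content g * content h" unfolding assms(4) by (rule content_mult)
  ultimately have "content h = normalize a" using assms(2) by simp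
  then have "smult (normalize a) (g * primitive_part h) = smult a f"
    using content_times_primitive_part[of h] assms(4) by (metis mult_smult_right)
  also have "\<dots> = smult (normalize a) (smult (unit_factor a) f)"
    by (simp add: mult.commute[of "normalize a"])
  finally have "smult (normalize a) (g * primitive_part h - smult (unit_factor a) f) = 0"
    by (simp only: smult_diff_right) simp
  then have "g * primitive_part h = smult (unit_factor a) f" using assms(3) by simp
  moreover obtain v where "1 = unit_factor a * v"
    using assms(3) unit_factor_is_unit by blast
  ultimately have "f = g * smult v (primitive_part h)"
    by (simp add: mult.commute[of v])
  then show ?thesis by (rule dvdI)
qed

text \<open>The trinomial \<open>y ^ (n + 1) - (1 + X - X ^ 3) y ^ n + X\<close> reduces to \<open>y ^ n (y - 1)\<close> at \<open>X = 0\<close>. Since its constant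
  term \<open>X\<close> is prime, a factorisation would have to separate the roots of \<open>y ^ n\<close> from that of \<open>y - 1\<close>,
  so the factor vanishing at \<open>q\<close> would be linear.\<close>

lemma trinomial_root_degree:
  fixes q :: "complex fps" and G :: "complex poly poly"
  assumes n: "n \<noteq> 0" and q: "q ^ n * (fps_X - fps_X ^ 3 + 1 - q) = fps_X" and q0: "fps_nth q 0 = 1"
    and G: "G \<noteq> 0" "eval_fps G q = 0"
  shows "n < degree G"
proof -
  define f :: "complex poly poly" where
    "f = monom 1 (Suc n) - monom [:1, 1, 0, -1:] n + [:[:0, 1:]:]"
  have X1: "fps_of_poly [:0, 1:] = (fps_X :: complex fps)" by (simp add: fps_of_poly_pCons)
  have X3: "fps_of_poly [:1, 1, 0, -1:] = 1 + fps_X - (fps_X ^ 3 :: complex fps)"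
    by (simp add: fps_of_poly_pCons power3_eq_cube algebra_simps)
  have f_root: "eval_fps f q = 0"
    using q by (simp add: f_def eval_fps_monom X1 X3 algebra_simps)
  have coeff_f: "coeff f i = (if i = Suc n then 1 else if i = n then - [:1, 1, 0, -1:]
      else if i = 0 then [:0, 1:] else 0)" for i
    using n by (auto simp: f_def coeff_pCons split: nat.splits)
  have deg_f: "degree f = Suc n"
    by (intro antisym degree_le le_degree) (auto simp: coeff_f)
  have monic_f: "lead_coeff f = 1" by (simp add: deg_f coeff_f)
  have f0: "at_0 f = monom 1 n * [:-1, 1:]"
    using n by (intro poly_eqI) (auto simp: coeff_at_0 coeff_f coeff_monom_mult coeff_pCons split: nat.splits)
  \<comment> \<open>The primitive part of an annihilator of least degree will divide
    \<open>f\<close> over C[X]. It remains to bound its degree from below.\<close>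
  obtain g0 where g0: "g0 \<noteq> 0" "eval_fps g0 q = 0"
      and min: "\<And>r. r \<noteq> 0 \<Longrightarrow> eval_fps r q = 0 \<Longrightarrow> degree g0 \<le> degree r"
    using ex_has_least_nat[of "\<lambda>g. g \<noteq> 0 \<and> eval_fps g q = 0" G degree] G by blast
  define g where "g = primitive_part g0"
  have g: "g \<noteq> 0" "degree g = degree g0" "content g = 1" using g0 by (simp_all add: g_def)
  have "eval_fps (smult (content g0) g) q = 0" unfolding g_def using g0 by simp
  then have g_root: "eval_fps g q = 0" using g0(1) by simp
  obtain a h where a: "a \<noteq> 0" "smult a f = g * h + pseudo_mod f g"
    using pseudo_mod(1)[OF g(1), of f] by blast
  have "eval_fps (pseudo_mod f g) q = eval_fps (smult a f) q - eval_fps (g * h) q"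
    unfolding a(2) by simp
  then have "eval_fps (pseudo_mod f g) q = 0" by (simp only: eval_fps_smult eval_fps_mult f_root g_root) simp
  then have "pseudo_mod f g = 0" using pseudo_mod(2)[OF g(1), of f] min[of "pseudo_mod f g"] g(2) by fastforce
  then have "g dvd f" using primitive_dvd_monic[OF monic_f g(3) a(1), of h] a(2) by simp
  then obtain k where k: "f = g * k" by blast
  have k_nz: "k \<noteq> 0" using k monic_f by auto
  have lc: "lead_coeff g * lead_coeff k = 1" using k monic_f by (simp add: lead_coeff_mult)
  then have "poly (lead_coeff g) 0 * poly (lead_coeff k) 0 = 1" by (metis poly_1 poly_mult)
  then have deg0: "degree (at_0 g) = degree g" "degree (at_0 k) = degree k"
    by (auto intro!: degree_at_0)
  have deg: "degree g + degree k = Suc n" using deg_f g(1) k_nz by (simp add: k degree_mult_eq)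
  have prod0: "monom 1 n * [:-1, 1:] = at_0 g * at_0 k" using f0 k at_0_mult by simp
  have trinomial_nz: "monom 1 n * [:-1, 1:] \<noteq> (0 :: complex poly)"
    by (simp only: mult_eq_0_iff monom_eq_0_iff) simp
  have nz0: "at_0 g \<noteq> 0" "at_0 k \<noteq> 0"
    using trinomial_nz unfolding prod0 by (simp_all only: mult_eq_0_iff) simp_all
  have root1: "poly (at_0 g) 1 = 0" using nth_0_eval_fps[of g q] g_root q0 by simp
  have const: "coeff g 0 * coeff k 0 = [:0, 1:]"
    using coeff_f[of 0] n by (simp add: k coeff_mult)
  have X_pow: "(monom 1 n :: complex poly) = [:- 0, 1:] ^ n" for n :: nat
    by (simp add: monom_altdef)
  have power_dvd: "monom 1 n dvd u" if uv: "monom 1 n * [:-1, 1:] = u * v" "poly v 0 \<noteq> 0" for u v :: "complex poly"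
  proof -
    have uv0: "u \<noteq> 0" "v \<noteq> 0" using trinomial_nz unfolding uv(1) by (simp_all only: mult_eq_0_iff) simp_all
    have "[:- 0, 1:] ^ n dvd u * v" using uv(1) by (metis X_pow dvd_triv_left)
    then have "n \<le> order 0 (u * v)" using uv0 order_divides[of 0 n "u * v"] by simp
    also have "\<dots> = order 0 u" using uv uv0 by (simp add: order_mult order_0I)
    finally show ?thesis using uv0 by (simp only: X_pow order_divides) simp
  qed
  have "n < degree g"
  proof (cases "poly (at_0 k) 0 = 0")
    \<comment> \<open>Modulo X, all of \<open>y ^ n\<close> goes into \<open>g\<close>, which also
      vanishes at 1, the constant coefficient of \<open>q\<close>.\<close>
    case False
    obtain r where r: "at_0 g = monom 1 n * r" using power_dvd[OF prod0 False] by blast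
    then have "r \<noteq> 0" "poly r 1 = 0" using nz0(1) root1 by (auto simp: poly_monom)
    then have "degree r \<noteq> 0" by (rule root_imp_degree_nonzero)
    then show ?thesis
      using deg0(1) \<open>r \<noteq> 0\<close> by (simp add: r degree_mult_eq degree_monom_eq monom_eq_0_iff)
  next
    \<comment> \<open>X divides the constant term of \<open>k\<close>. The two constant terms
      multiply to X, so that of \<open>g\<close> is a unit and \<open>y ^ n\<close> goes into
      \<open>k\<close> modulo X. This leaves \<open>g\<close> linear with unit coefficients, so
      \<open>q\<close> is constant.\<close>
    case True
    then have "[:0, 1:] dvd coeff k 0"
      using poly_eq_0_iff_dvd[of "coeff k 0" 0] by (simp add: poly_0_coeff_0 coeff_at_0)
    then obtain e where e: "coeff k 0 = [:0, 1:] * e" by blast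
    have "[:0, 1:] * (coeff g 0 * e) = [:0, 1:] * 1" using const e by (simp only: mult.left_commute mult_1_right)
    then have unit_g: "coeff g 0 * e = 1" by (metis mult_left_cancel pCons_eq_0_iff zero_neq_one)
    then have "poly (coeff g 0) 0 * poly e 0 = 1" by (metis poly_1 poly_mult)
    then have "poly (at_0 g) 0 \<noteq> 0" by (auto simp: poly_0_coeff_0 coeff_at_0)
    then have "monom 1 n dvd at_0 k" using power_dvd[of "at_0 k" "at_0 g"] prod0 by (simp add: mult.commute)
    then have "n \<le> degree k"
      using dvd_imp_degree_le[of "monom 1 n" "at_0 k"] nz0 deg0 by (simp add: degree_monom_eq)
    moreover have "degree g \<noteq> 0"
      using root_imp_degree_nonzero[OF nz0(1) root1] deg0 by simp
    ultimately have "degree g = 1" using deg by linarith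
    then have "g = [:coeff g 0, coeff g 1:]"
      by (intro poly_eqI) (auto simp: coeff_pCons coeff_eq_0 split: nat.splits)
    moreover have "coeff g 1 \<noteq> 0" using \<open>degree g = 1\<close> g(1) by (metis leading_coeff_0_iff)
    ultimately obtain b c where bc: "g = [:b, c:]" "c \<noteq> 0" by blast
    have "is_unit b" using unit_g bc by (metis coeff_pCons_0 dvdI)
    then obtain b' where b': "b = [:b':]" by (rule is_unit_polyE)
    have "is_unit c" using lc bc by (auto intro: dvdI)
    then obtain c' where c': "c = [:c':]" by (rule is_unit_polyE)
    then have "c' \<noteq> 0" using bc by auto
    note bc' = b' c' this
    have "fps_const b' + q * fps_const c' = 0" using g_root by (simp add: bc bc' fps_of_poly_const)
    then have coeffs: "fps_nth (fps_const b') i + fps_nth q i * c' = 0" for i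
      by (metis fps_add_nth fps_mult_right_const_nth fps_zero_nth)
    have "fps_nth q i = (if i = 0 then 1 else 0)" for i
      using coeffs[of i] q0 bc'(3) by (cases "i = 0") simp_all
    then have "q = 1" by (intro fps_ext) simp
    \<comment> \<open>For \<open>q = 1\<close> the trinomial equation reads
      \<open>X - X^3 = X\<close>.\<close>
    then have "fps_X ^ 3 = (0 :: complex fps)" using q by simp
    then show ?thesis by simp
  qed
  also have "degree g \<le> degree G" using g(2) min G by simp
  finally show ?thesis .
qed

text \<open>By \<open>P = (1 - q) / X^3\<close> the factors \<open>1 - X P\<close> and
  \<open>1 - X^2 P\<close> are linear in \<open>q\<close>. Clearing denominators in
  \<open>S = A / B\<close> therefore gives a nonzero polynomial \<open>G\<close> of degree at most 2
  with root \<open>q\<close>.\<close>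

lemma irrational_of_trinomial:
  fixes S P :: "complex fps"
  assumes n: "2 \<le> n" and P: "(1 - fps_X ^ 3 * P) ^ n * (1 - fps_X\<^sup>2 + fps_X\<^sup>2 * P) = 1"
    and S: "S * ((1 - fps_X * P) * (1 - fps_X\<^sup>2 * P)) = P * (1 - fps_X\<^sup>2)"
  shows "\<not> rational_fps S"
proof
  assume "rational_fps S"
  then obtain A B where AB: "B \<noteq> 0" "S * fps_of_poly B = fps_of_poly A"
    unfolding rational_fps_def by blast
  define q where "q = 1 - fps_X ^ 3 * P"
  define c :: "complex poly" where "c = [:1, 0, -1:]"
  define G where "G = smult A ([:-c, 1:] * [:[:-1, 1:], 1:]) + smult (B * c) [:-1, 1:]"
  have c: "c \<noteq> 0" "fps_of_poly c = 1 - fps_X\<^sup>2"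
    by (simp_all add: c_def fps_of_poly_pCons power2_eq_square)
  have "coeff G 2 = A" "A = 0 \<Longrightarrow> coeff G 1 = B * c"
    by (simp_all add: G_def numeral_2_eq_2)
  then have "G \<noteq> 0" using AB(1) c(1) by (cases "A = 0") auto
  moreover have "eval_fps G q = 0"
  proof -
    have "eval_fps G q = fps_of_poly A * ((q - (1 - fps_X\<^sup>2)) * (q - (1 - fps_X)))
        + fps_of_poly B * (1 - fps_X\<^sup>2) * (q - 1)"
    proof -
      have "eval_fps [:b, 1:] q = fps_of_poly b + q" for b by simp
      moreover have "fps_of_poly (- c) = - (1 - fps_X\<^sup>2)" by (simp only: fps_of_poly_uminus c)
      moreover have "fps_of_poly [:-1, 1:] = fps_X - (1 :: complex fps)" by (simp add: fps_of_poly_pCons)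
      moreover have "eval_fps [:-1, 1:] q = q - 1" by (simp add: one_pCons)
      ultimately show ?thesis
        by (simp only: G_def eval_fps_add eval_fps_smult eval_fps_mult fps_of_poly_mult c)
          (simp add: algebra_simps)
    qed
    also have "\<dots> = fps_X ^ 3 * fps_of_poly B * (S * ((1 - fps_X * P) * (1 - fps_X\<^sup>2 * P)) - P * (1 - fps_X\<^sup>2))"
      unfolding AB(2)[symmetric] q_def by (simp add: algebra_simps power2_eq_square power3_eq_cube)
    also have "\<dots> = 0" by (simp add: S)
    finally show ?thesis .
  qed
  \<comment> \<open>X times the second factor of the window equation is
    \<open>X - X^3 + X^3 P\<close>, which is \<open>X - X^3 + 1 - q\<close>.\<close>
  moreover have "q ^ n * (fps_X - fps_X ^ 3 + 1 - q) = fps_X * (q ^ n * (1 - fps_X\<^sup>2 + fps_X\<^sup>2 * P))"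
    unfolding q_def by (simp add: algebra_simps power2_eq_square power3_eq_cube)
  then have "q ^ n * (fps_X - fps_X ^ 3 + 1 - q) = fps_X" using P by (simp add: q_def)
  moreover have "fps_nth q 0 = 1" by (simp add: q_def)
  ultimately have "n < degree G" using n by (intro trinomial_root_degree) auto
  moreover have "degree G \<le> 2"
    by (rule degree_le) (auto simp: G_def coeff_pCons numeral_2_eq_2 split: nat.splits)
  ultimately show False using n by simp
qed

theorem theorem4p3:
  fixes p :: nat
  assumes "p \<ge> 3"
  shows "\<not> rational_fps (pos_growth p)"
proof -
  obtain n where p: "p = Suc n" and n: "2 \<le> n" using assms by (cases p) auto
  have "pos_growth p = gen_fun (normal_forms n) (nf_cost n)"
    using n by (simp add: pos_growth_def gen_fun_def p pos_count_eq)
  then show ?thesis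
    using irrational_of_trinomial[OF n window_gf_equation normal_forms_gf] by simp
qed

end
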